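(* Let $P_{XYZ}$ be a joint distribution on finite alphabets $\mathcal{X},\mathcal{Y},\mathcal{Z}$. Then: 1) (Data processing inequality) If the Markov chain $X-Y-V|Z$ holds for a discrete random variable $V$, then $\mathcal{L}(X\to V|Z)\le\min\{\mathcal{L}(X\to Y|Z),\mathcal{L}(Y\to V|Z)\}$. 2) $\mathcal{L}(X\to Y|Z)\le\min\{\log|\mathcal{X}|,\log|\mathcal{Y}|\}$. 3) $\mathcal{L}(X\to Y|Z)=0$ if and only if the Markov chain $X-Z-Y$ holds. 4) (Additivity) If $(X_i,Y_i,Z_i)$, $i=1,\dots,n$, are mutually independent triples (on finite alphabets), then $\mathcal{L}(X_1^n\to Y_1^n|Z_1^n)=\sum_{i=1}^n\mathcal{L}(X_i\to Y_i|Z_i)$. 5) $\mathcal{L}(X\to Y|Z)\ge I(X;Y|Z)$. 6) $\mathcal{L}(X\to Y|Z)$ is not symmetric in $X$ and $Y$; i.e., there exists a joint distribution with $\mathcal{L}(X\to Y|Z)\ne\mathcal{L}(Y\to X|Z)$. 7) If the Markov chain $Z-X-Y$ holds, then $\mathcal{L}(X\to Y|Z)\le\mathcal{L}(X\to Y)$, with equality if for some $z\in\mathrm{supp}(Z)$, $\mathrm{supp}(P_{X|Z=z})=\mathrm{supp}(P_X)$. 8) $\mathcal{L}(X\to(Y,Z))\le\mathcal{L}(X\to Z)+\mathcal{L}(X\to Y|Z)$.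
   Context: $\log$ is the natural logarithm (also used in mutual information). $A-B-C$ denotes a Markov chain; $A-B-C|Z$ means $A$ and $C$ are conditionally independent given $(B,Z)$, equivalently $A-(B,Z)-C$. The maximal leakage is $$\mathcal{L}(X\to Y)=\sup_{U-X-Y-\hat U}\log\frac{\Pr(U=\hat U)}{\max_{u}P_U(u)},$$ the supremum being over all $U,\hat U$ taking values in the same finite, but arbitrary, alphabet. The conditional maximal leakage is $$\mathcal{L}(X\to Y|Z)=\sup_{U:\,U-X-Y|Z}\log\frac{\Pr(U=\hat U(Y,Z))}{\Pr(U=\tilde U(Z))},$$ where $U$ takes values in a finite, but arbitrary, alphabet, and $\hat U(Y,Z)$, $\tilde U(Z)$ are the optimal (maximum a posteriori) estimators of $U$ given $(Y,Z)$ and given $Z$, respectively. $\mathrm{supp}$ denotes the set of values of positive probability. *)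

theory Defs
  imports "HOL-Probability.Probability"
begin

text \<open>
  Discrete random variables are functions on a sample space of type \<open>'w\<close> that carries a
  probability mass function \<open>p\<close>; the joint distribution of \<open>X\<close>, \<open>Y\<close>, \<open>Z\<close> is
  \<open>map_pmf (\<lambda>\<omega>. (X \<omega>, Y \<omega>, Z \<omega>)) p\<close>.
\<close>

text \<open>
  The Markov chain \<open>A - B - C\<close>: given \<open>B\<close>, the variables \<open>A\<close> and \<open>C\<close> are independent.
\<close>

definition markov_chain :: "'w pmf \<Rightarrow> ('w \<Rightarrow> 'a) \<Rightarrow> ('w \<Rightarrow> 'b) \<Rightarrow> ('w \<Rightarrow> 'c) \<Rightarrow> bool" where
  "markov_chain p A B C \<longleftrightarrow>
     (\<forall>b \<in> set_pmf (map_pmf B p). \<forall>a c.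
        \<P>(\<omega> in measure_pmf p. (A \<omega> = a \<and> C \<omega> = c) \<bar> B \<omega> = b) =
        \<P>(\<omega> in measure_pmf p. A \<omega> = a \<bar> B \<omega> = b) *
        \<P>(\<omega> in measure_pmf p. C \<omega> = c \<bar> B \<omega> = b))"

text \<open>The Markov chain \<open>A - B - C | Z\<close>.\<close>

definition markov_chain_given ::
  "'w pmf \<Rightarrow> ('w \<Rightarrow> 'a) \<Rightarrow> ('w \<Rightarrow> 'b) \<Rightarrow> ('w \<Rightarrow> 'c) \<Rightarrow> ('w \<Rightarrow> 'z) \<Rightarrow> bool" where
  "markov_chain_given p A B C Z \<longleftrightarrow> markov_chain p A (\<lambda>\<omega>. (B \<omega>, Z \<omega>)) C"

text \<open>
  The Markov chain \<open>A - B - C - D\<close>: the joint distribution factors as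
  \<open>P\<^sub>A\<^sub>B(a, b) P\<^sub>C\<^sub>|\<^sub>B(c|b) P\<^sub>D\<^sub>|\<^sub>C(d|c)\<close>.
\<close>

definition markov_chain4 ::
  "'w pmf \<Rightarrow> ('w \<Rightarrow> 'a) \<Rightarrow> ('w \<Rightarrow> 'b) \<Rightarrow> ('w \<Rightarrow> 'c) \<Rightarrow> ('w \<Rightarrow> 'd) \<Rightarrow> bool" where
  "markov_chain4 p A B C D \<longleftrightarrow>
     markov_chain p A B C \<and> markov_chain p (\<lambda>\<omega>. (A \<omega>, B \<omega>)) C D"

text \<open>
  Natural logarithm with \<open>log 0 = -\<infinity>\<close> (the library has \<open>ln 0 = 0\<close>). In the definition of maximal
  leakage the argument is zero if \<open>U\<close> and its estimate never agree.
\<close>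

definition elog :: "real \<Rightarrow> ereal" where
  "elog x = (if x = 0 then - \<infinity> else ereal (ln x))"

text \<open>
  The supremum in the next definition ranges over all joint distributions \<open>q\<close> of
  \<open>(U, X, Y, V)\<close>, where \<open>V\<close> estimates \<open>U\<close>, that extend the given distribution of \<open>(X, Y)\<close>. Every finite alphabet is in
  bijection with a finite set of natural numbers, so these suffice as alphabets for \<open>U\<close>.
  The supremum is taken in the extended reals and hence always meaningful.
\<close>

definition max_leakage :: "'w pmf \<Rightarrow> ('w \<Rightarrow> 'x) \<Rightarrow> ('w \<Rightarrow> 'y) \<Rightarrow> ereal" where
  "max_leakage p X Y =
     (let U = (\<lambda>(u, x, y, v). u); X' = (\<lambda>(u, x, y, v). x);
          Y' = (\<lambda>(u, x, y, v). y); V = (\<lambda>(u, x, y, v). v)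
      in SUP (\<U>, q) \<in> {(\<U> :: nat set, q :: (nat \<times> 'x \<times> 'y \<times> nat) pmf).
           finite \<U> \<and> set_pmf (map_pmf U q) \<subseteq> \<U> \<and> set_pmf (map_pmf V q) \<subseteq> \<U> \<and>
           map_pmf (\<lambda>\<omega>. (X' \<omega>, Y' \<omega>)) q = map_pmf (\<lambda>\<omega>. (X \<omega>, Y \<omega>)) p \<and>
           markov_chain4 q U X' Y' V}.
         elog (\<P>(\<omega> in measure_pmf q. U \<omega> = V \<omega>) / (MAX u\<in>\<U>. pmf (map_pmf U q) u)))"

text \<open>
  Maximum a posteriori estimate of \<open>U\<close>, with finite alphabet \<open>\<U>\<close>, from the observation \<open>S = s\<close>.
  Ties are broken by \<^const>\<open>arg_max_on\<close>.
\<close>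

definition map_estimator ::
  "'w pmf \<Rightarrow> 'u set \<Rightarrow> ('w \<Rightarrow> 'u) \<Rightarrow> ('w \<Rightarrow> 's) \<Rightarrow> 's \<Rightarrow> 'u" where
  "map_estimator p \<U> U S s = arg_max_on (\<lambda>u. \<P>(\<omega> in measure_pmf p. U \<omega> = u \<bar> S \<omega> = s)) \<U>"

definition cond_max_leakage ::
  "'w pmf \<Rightarrow> ('w \<Rightarrow> 'x) \<Rightarrow> ('w \<Rightarrow> 'y) \<Rightarrow> ('w \<Rightarrow> 'z) \<Rightarrow> ereal" where
  "cond_max_leakage p X Y Z =
     (let U = (\<lambda>(u, x, y, z). u); X' = (\<lambda>(u, x, y, z). x);
          Y' = (\<lambda>(u, x, y, z). y); Z' = (\<lambda>(u, x, y, z). z)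
      in SUP (\<U>, q) \<in> {(\<U> :: nat set, q :: (nat \<times> 'x \<times> 'y \<times> 'z) pmf).
           finite \<U> \<and> set_pmf (map_pmf U q) \<subseteq> \<U> \<and>
           map_pmf (\<lambda>\<omega>. (X' \<omega>, Y' \<omega>, Z' \<omega>)) q = map_pmf (\<lambda>\<omega>. (X \<omega>, Y \<omega>, Z \<omega>)) p \<and>
           markov_chain_given q U X' Y' Z'}.
         elog (\<P>(\<omega> in measure_pmf q.
                   U \<omega> = map_estimator q \<U> U (\<lambda>\<omega>. (Y' \<omega>, Z' \<omega>)) (Y' \<omega>, Z' \<omega>)) /
               \<P>(\<omega> in measure_pmf q. U \<omega> = map_estimator q \<U> U Z' (Z' \<omega>))))"

text \<open>Conditional mutual information in nats, for variables with finite alphabets.\<close>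

abbreviation cond_mutual_info ::
  "'w pmf \<Rightarrow> 'x set \<Rightarrow> 'y set \<Rightarrow> 'z set \<Rightarrow> ('w \<Rightarrow> 'x) \<Rightarrow> ('w \<Rightarrow> 'y) \<Rightarrow> ('w \<Rightarrow> 'z) \<Rightarrow> real" where
  "cond_mutual_info p \<X> \<Y> \<Z> X Y Z \<equiv>
     prob_space.conditional_mutual_information (measure_pmf p) (exp 1)
       (count_space \<X>) (count_space \<Y>) (count_space \<Z>) X Y Z"

end

theory Submission
  imports Defs
begin

text \<open>
  Everything follows from the closed form
  \<open>\<L>(X \<rightarrow> Y|Z) = log max\<^sub>z \<Sum>\<^sub>y max\<^sub>x P(y|x, z)\<close>, with \<open>z\<close> and \<open>x\<close> ranging over the supports of
  \<open>P\<^sub>Z\<close> and \<open>P\<^sub>X\<^sub>|\<^sub>Z\<^sub>=\<^sub>z\<close>. The upper bound holds since \<open>P(u, y, z) \<le> P(u, z) max\<^sub>x P(y|x, z)\<close> for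
  \<open>U - (X, Z) - Y\<close>. For the lower bound, fix the best \<open>z\<close> and choose \<open>U\<close> to be an almost uniform
  relabelling of \<open>X\<close> for that \<open>z\<close> and very hard to guess for the others. The unconditional
  leakage is the case of constant \<open>Z\<close>: randomising the estimator does not help.
\<close>

section \<open>The sum of maxima of a conditional distribution\<close>

text \<open>The ratio of guessing probabilities is a quotient of two averages over \<open>z\<close>,
  hence at most the largest quotient at a single \<open>z\<close>. To come close to that bound, the
  other \<open>z\<close> must drop out of the denominator; this is why \<open>U\<close> has to be
  hard to guess there, and the construction reaches the bound only in the limit of many extra
  symbols. At the chosen \<open>z\<close> the names of the \<open>x\<close> are made equally likely,
  so that the law of \<open>X\<close> gives a blind guess no advantage and only the channel matters.
  With the logarithm removed, the claims concern sums of maxima alone: data processing and the chain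
  rule compare such sums termwise, independence makes maxima and sums factor, and the bound by
  mutual information is Jensen's inequality. The sums are \<open>ennreal\<close> integrals over
  counting measures, because the variable \<open>V\<close> in the data processing inequality has an
  arbitrary discrete alphabet; a finite support of \<open>X\<close> keeps them finite.\<close>

lemma nn_integral_prob_slices:
  "(\<integral>\<^sup>+y. ennreal (measure (measure_pmf p) {\<omega>. P \<omega> \<and> Y \<omega> = y}) \<partial>count_space UNIV) = ennreal (measure p {\<omega>. P \<omega>})"
proof -
  \<comment> \<open>The slices are the point masses of \<open>q\<close> in the row
    \<open>True\<close>, so total probability becomes the mass of that row.\<close>
  define q where "q = map_pmf (\<lambda>\<omega>. (P \<omega>, Y \<omega>)) p"
  have "(\<integral>\<^sup>+y. ennreal (measure (measure_pmf p) {\<omega>. P \<omega> \<and> Y \<omega> = y}) \<partial>count_space UNIV)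
      = (\<integral>\<^sup>+y. ennreal (pmf q (True, y)) \<partial>count_space UNIV)"
    unfolding q_def pmf_map by (intro nn_integral_cong arg_cong[where f = ennreal] arg_cong2[where f = measure]) auto
  also have "\<dots> = (\<integral>\<^sup>+s. ennreal (pmf q s) \<partial>count_space (Pair True ` UNIV))"
    by (rule nn_integral_bij_count_space) (auto simp: bij_betw_def inj_on_def)
  also have "\<dots> = emeasure q (Pair True ` UNIV)"
    by (rule nn_integral_pmf)
  also have "\<dots> = emeasure p ((\<lambda>\<omega>. (P \<omega>, Y \<omega>)) -` (Pair True ` UNIV))"
    by (simp add: q_def)
  also have "(\<lambda>\<omega>. (P \<omega>, Y \<omega>)) -` (Pair True ` UNIV) = {\<omega>. P \<omega>}"
    by auto
  finally show ?thesis
    by (simp add: measure_pmf.emeasure_eq_measure)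
qed

definition channel :: "'w pmf \<Rightarrow> ('w \<Rightarrow> 'x) \<Rightarrow> ('w \<Rightarrow> 'y) \<Rightarrow> ('w \<Rightarrow> 'z) \<Rightarrow> 'x \<Rightarrow> 'y \<Rightarrow> 'z \<Rightarrow> real" where
  "channel p X Y Z x y z =
     measure p {\<omega>. X \<omega> = x \<and> Z \<omega> = z \<and> Y \<omega> = y} / measure p {\<omega>. X \<omega> = x \<and> Z \<omega> = z}"

text \<open>
  Where \<open>P(x, z) = 0\<close>, the division gives \<open>0\<close>; hence the suprema below effectively range over the
  \<open>x\<close> in the support of \<open>P\<^sub>X\<^sub>|\<^sub>Z\<^sub>=\<^sub>z\<close> and over the \<open>z\<close> in the support of \<open>P\<^sub>Z\<close>.
\<close>

definition sum_max_at :: "'w pmf \<Rightarrow> ('w \<Rightarrow> 'x) \<Rightarrow> ('w \<Rightarrow> 'y) \<Rightarrow> ('w \<Rightarrow> 'z) \<Rightarrow> 'z \<Rightarrow> ennreal" where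
  "sum_max_at p X Y Z z = (\<integral>\<^sup>+y. (SUP x. ennreal (channel p X Y Z x y z)) \<partial>count_space UNIV)"

definition sum_max :: "'w pmf \<Rightarrow> ('w \<Rightarrow> 'x) \<Rightarrow> ('w \<Rightarrow> 'y) \<Rightarrow> ('w \<Rightarrow> 'z) \<Rightarrow> ennreal" where
  "sum_max p X Y Z = (SUP z. sum_max_at p X Y Z z)"

lemma channel_nonneg [simp]: "0 \<le> channel p X Y Z x y z"
  by (simp add: channel_def)

lemma channel_mult:
  "channel p X Y Z x y z * measure p {\<omega>. X \<omega> = x \<and> Z \<omega> = z} = measure p {\<omega>. X \<omega> = x \<and> Z \<omega> = z \<and> Y \<omega> = y}"
proof (cases "measure p {\<omega>. X \<omega> = x \<and> Z \<omega> = z} = 0")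
  case True
  have "measure p {\<omega>. X \<omega> = x \<and> Z \<omega> = z \<and> Y \<omega> = y} \<le> measure p {\<omega>. X \<omega> = x \<and> Z \<omega> = z}"
    by (rule measure_pmf.finite_measure_mono) auto
  then show ?thesis
    using True by (simp add: measure_le_0_iff)
qed (simp add: channel_def)

lemma channel_le_1: "channel p X Y Z x y z \<le> 1"
proof -
  have "measure p {\<omega>. X \<omega> = x \<and> Z \<omega> = z \<and> Y \<omega> = y} \<le> measure p {\<omega>. X \<omega> = x \<and> Z \<omega> = z}"
    by (rule measure_pmf.finite_measure_mono) auto
  then show ?thesis
    by (simp add: channel_def divide_le_eq_1 less_le)
qed

text \<open>A row is a probability distribution unless its input is impossible, when division by
  zero makes it the zero row. Either way the sum is at most 1, which is what the upper bounds
  use.\<close>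

lemma channel_sum:
  "(\<integral>\<^sup>+y. ennreal (channel p X Y Z x y z) \<partial>count_space UNIV)
     = (if measure p {\<omega>. X \<omega> = x \<and> Z \<omega> = z} = 0 then 0 else 1)"
proof (cases "measure p {\<omega>. X \<omega> = x \<and> Z \<omega> = z} = 0")
  case False
  let ?c = "measure p {\<omega>. X \<omega> = x \<and> Z \<omega> = z}"
  have pos: "?c > 0"
    using False by (simp add: less_le)
  have "(\<integral>\<^sup>+y. ennreal (channel p X Y Z x y z) \<partial>count_space UNIV)
      = (\<integral>\<^sup>+y. ennreal (measure p {\<omega>. (X \<omega> = x \<and> Z \<omega> = z) \<and> Y \<omega> = y}) / ennreal ?c \<partial>count_space UNIV)"
    unfolding channel_def using pos by (intro nn_integral_cong) (simp add: divide_ennreal conj_assoc)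
  also have "\<dots> = ennreal ?c / ennreal ?c"
    by (subst nn_integral_divide) (simp_all only: nn_integral_prob_slices borel_measurable_count_space)
  also have "\<dots> = 1"
    using pos by (simp add: divide_ennreal)
  finally show ?thesis
    using False by simp
qed (simp add: channel_def)

lemma sum_max_at_le: "sum_max_at p X Y Z z \<le> sum_max p X Y Z"
  unfolding sum_max_def by (rule SUP_upper) simp

text \<open>The leakages range over joint distributions on other sample spaces. Everything built
  from the channel depends only on the law of the triple and so can be carried there and
  back.\<close>

lemma channel_cong_joint:
  assumes "map_pmf (\<lambda>\<omega>. (X \<omega>, Y \<omega>, Z \<omega>)) p = map_pmf (\<lambda>\<omega>. (X' \<omega>, Y' \<omega>, Z' \<omega>)) q"
  shows "channel p X Y Z = channel q X' Y' Z'"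
proof (intro ext)
  fix x y z
  have *: "measure p {\<omega>. Q (X \<omega>) (Y \<omega>) (Z \<omega>)} = measure q {\<omega>. Q (X' \<omega>) (Y' \<omega>) (Z' \<omega>)}" for Q
    using arg_cong[OF assms, of "\<lambda>r. measure r {(x, y, z). Q x y z}"] by (simp add: vimage_def)
  show "channel p X Y Z x y z = channel q X' Y' Z' x y z"
    unfolding channel_def
    by (simp add: *[of "\<lambda>x' y' z'. x' = x \<and> z' = z \<and> y' = y"] *[of "\<lambda>x' y' z'. x' = x \<and> z' = z"])
qed

lemma sum_max_cong_joint:
  assumes "map_pmf (\<lambda>\<omega>. (X \<omega>, Y \<omega>, Z \<omega>)) p = map_pmf (\<lambda>\<omega>. (X' \<omega>, Y' \<omega>, Z' \<omega>)) q"
  shows "sum_max_at p X Y Z = sum_max_at q X' Y' Z'" "sum_max p X Y Z = sum_max q X' Y' Z'"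
  by (simp_all add: sum_max_def sum_max_at_def[abs_def] channel_cong_joint[OF assms])

section \<open>Markov chains as product identities without conditional probabilities\<close>

lemma markov_chain_measure:
  assumes "markov_chain p A B C"
  shows "measure p {\<omega>. A \<omega> = a \<and> B \<omega> = b \<and> C \<omega> = c} * measure p {\<omega>. B \<omega> = b}
    = measure p {\<omega>. A \<omega> = a \<and> B \<omega> = b} * measure p {\<omega>. B \<omega> = b \<and> C \<omega> = c}"
proof (cases "b \<in> B ` set_pmf p")
  case True
  then have pos: "measure p {\<omega>. B \<omega> = b} > 0"
    by (auto intro: measure_pmf_posI)
  have "\<P>(\<omega> in p. (A \<omega> = a \<and> C \<omega> = c) \<bar> B \<omega> = b) = \<P>(\<omega> in p. A \<omega> = a \<bar> B \<omega> = b) * \<P>(\<omega> in p. C \<omega> = c \<bar> B \<omega> = b)"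
    using assms True unfolding markov_chain_def set_map_pmf by blast
  then show ?thesis
    using pos by (simp add: cond_prob_def field_simps conj_ac)
next
  case False
  then have "measure p {\<omega>. B \<omega> = b} = 0" "measure p {\<omega>. A \<omega> = a \<and> B \<omega> = b} = 0"
    by (auto simp: measure_pmf_zero_iff)
  then show ?thesis by simp
qed

lemma markov_chainI:
  assumes "\<And>a b c. b \<in> B ` set_pmf p \<Longrightarrow>
    measure p {\<omega>. A \<omega> = a \<and> B \<omega> = b \<and> C \<omega> = c} * measure p {\<omega>. B \<omega> = b}
    = measure p {\<omega>. A \<omega> = a \<and> B \<omega> = b} * measure p {\<omega>. B \<omega> = b \<and> C \<omega> = c}"
  shows "markov_chain p A B C"
  unfolding markov_chain_def
proof (intro ballI allI)
  fix a b c assume b: "b \<in> set_pmf (map_pmf B p)"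
  then have pos: "measure p {\<omega>. B \<omega> = b} > 0"
    by (auto intro: measure_pmf_posI)
  then show "\<P>(\<omega> in p. (A \<omega> = a \<and> C \<omega> = c) \<bar> B \<omega> = b) = \<P>(\<omega> in p. A \<omega> = a \<bar> B \<omega> = b) * \<P>(\<omega> in p. C \<omega> = c \<bar> B \<omega> = b)"
    using assms[of b a c] b by (simp add: cond_prob_def field_simps conj_ac)
qed

section \<open>Guessing probabilities\<close>

text \<open>\<open>arg_max_on\<close> is a choice operator, so a maximiser must first be exhibited;
  a finite nonempty alphabet has one. Dividing by \<open>P(s)\<close> does not affect the order, so
  the estimator also maximises the joint probability, the form that can be summed over
  \<open>s\<close>.\<close>

lemma map_estimator:
  assumes "finite \<U>" "\<U> \<noteq> {}"
  shows map_estimator_in: "map_estimator p \<U> U S s \<in> \<U>"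
    and map_estimator_max: "u \<in> \<U> \<Longrightarrow>
      measure p {\<omega>. U \<omega> = u \<and> S \<omega> = s} \<le> measure p {\<omega>. U \<omega> = map_estimator p \<U> U S s \<and> S \<omega> = s}"
proof -
  let ?f = "\<lambda>u. \<P>(\<omega> in measure_pmf p. U \<omega> = u \<bar> S \<omega> = s)"
  have "Max (?f ` \<U>) \<in> ?f ` \<U>"
    using assms by (intro Max_in) auto
  then obtain k where "k \<in> \<U>" "?f k = Max (?f ` \<U>)" by force
  then have "is_arg_max ?f (\<lambda>u. u \<in> \<U>) k"
    unfolding is_arg_max_linorder using assms by simp
  then have *: "is_arg_max ?f (\<lambda>u. u \<in> \<U>) (map_estimator p \<U> U S s)"
    unfolding map_estimator_def arg_max_on_def arg_max_def by (rule someI)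
  then show "map_estimator p \<U> U S s \<in> \<U>"
    by (simp add: is_arg_max_linorder)
  assume "u \<in> \<U>"
  then have le: "?f u \<le> ?f (map_estimator p \<U> U S s)"
    using * by (simp add: is_arg_max_linorder)
  show "measure p {\<omega>. U \<omega> = u \<and> S \<omega> = s} \<le> measure p {\<omega>. U \<omega> = map_estimator p \<U> U S s \<and> S \<omega> = s}"
  proof (cases "measure p {\<omega>. S \<omega> = s} = 0")
    case True
    have "measure p {\<omega>. U \<omega> = u \<and> S \<omega> = s} \<le> measure p {\<omega>. S \<omega> = s}"
      by (rule measure_pmf.finite_measure_mono) auto
    then show ?thesis
      using True by (simp add: measure_le_0_iff)
  next
    case False
    then have "measure p {\<omega>. S \<omega> = s} > 0"
      by (simp add: less_le)
    then show ?thesis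
      using le by (simp add: cond_prob_def divide_le_cancel)
  qed
qed

text \<open>On the slice \<open>S = s\<close> the guess \<open>h (S \<omega>)\<close> is the fixed
  symbol \<open>h s\<close>; the rest is total probability.\<close>

lemma guess_slices:
  "(\<integral>\<^sup>+s. ennreal (measure (measure_pmf p) {\<omega>. U \<omega> = h s \<and> S \<omega> = s}) \<partial>count_space UNIV)
     = ennreal (measure p {\<omega>. U \<omega> = h (S \<omega>)})"
proof -
  have "{\<omega>. U \<omega> = h s \<and> S \<omega> = s} = {\<omega>. U \<omega> = h (S \<omega>) \<and> S \<omega> = s}" for s
    by auto
  then show ?thesis
    using nn_integral_prob_slices[of p "\<lambda>\<omega>. U \<omega> = h (S \<omega>)" S] by simp
qed

text \<open>The MAP estimator is optimal on every slice, hence on average. A guess outside the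
  alphabet is almost never correct and cannot beat it.\<close>

lemma guess_le_map_estimator:
  assumes "finite \<U>" "U ` set_pmf p \<subseteq> \<U>"
  shows "measure p {\<omega>. U \<omega> = h (S \<omega>)} \<le> measure p {\<omega>. U \<omega> = map_estimator p \<U> U S (S \<omega>)}"
proof -
  have "\<U> \<noteq> {}"
    using assms(2) set_pmf_not_empty[of p] by auto
  have "measure p {\<omega>. U \<omega> = h s \<and> S \<omega> = s} \<le> measure p {\<omega>. U \<omega> = map_estimator p \<U> U S s \<and> S \<omega> = s}" for s
  proof (cases "h s \<in> \<U>")
    case False
    then have "measure p {\<omega>. U \<omega> = h s \<and> S \<omega> = s} = 0"
      using assms(2) by (auto simp: measure_pmf_zero_iff)
    then show ?thesis by simp
  qed (rule map_estimator_max[OF assms(1) \<open>\<U> \<noteq> {}\<close>])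
  then have "ennreal (measure p {\<omega>. U \<omega> = h (S \<omega>)}) \<le> ennreal (measure p {\<omega>. U \<omega> = map_estimator p \<U> U S (S \<omega>)})"
    unfolding guess_slices[symmetric] by (intro nn_integral_mono ennreal_leI) simp
  then show ?thesis by simp
qed

text \<open>Always guessing one value that \<open>U\<close> attains already succeeds with positive
  probability. This allows division by guessing probabilities.\<close>

lemma map_estimator_prob_pos:
  assumes "finite \<U>" "U ` set_pmf p \<subseteq> \<U>"
  shows "0 < measure p {\<omega>. U \<omega> = map_estimator p \<U> U S (S \<omega>)}"
proof -
  obtain \<omega> where "\<omega> \<in> set_pmf p"
    using set_pmf_not_empty[of p] by blast
  then have "0 < measure p {\<omega>'. U \<omega>' = (\<lambda>_. U \<omega>) (S \<omega>')}"
    by (intro measure_pmf_posI) auto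
  also have "\<dots> \<le> measure p {\<omega>. U \<omega> = map_estimator p \<U> U S (S \<omega>)}"
    by (rule guess_le_map_estimator[OF assms])
  finally show ?thesis .
qed

text \<open>Split the event by the value of \<open>X\<close>: each piece is
  \<open>P(u, x, z) P(y|x, z)\<close>. Bounding the channel by its supremum leaves weights
  \<open>P(u, x, z)\<close> that add up to \<open>P(u, z)\<close>.\<close>

lemma markov_chain_given_joint_le:
  assumes "markov_chain_given p U X Y Z"
  shows "ennreal (measure p {\<omega>. U \<omega> = u \<and> Z \<omega> = z \<and> Y \<omega> = y})
    \<le> ennreal (measure p {\<omega>. U \<omega> = u \<and> Z \<omega> = z}) * (SUP x. ennreal (channel p X Y Z x y z))"
proof -
  have factor: "measure p {\<omega>. (U \<omega> = u \<and> Z \<omega> = z \<and> Y \<omega> = y) \<and> X \<omega> = x}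
      = measure p {\<omega>. (U \<omega> = u \<and> Z \<omega> = z) \<and> X \<omega> = x} * channel p X Y Z x y z" for x
  proof (cases "measure p {\<omega>. X \<omega> = x \<and> Z \<omega> = z} = 0")
    case True
    have "measure p {\<omega>. (U \<omega> = u \<and> Z \<omega> = z \<and> Y \<omega> = y) \<and> X \<omega> = x} \<le> measure p {\<omega>. X \<omega> = x \<and> Z \<omega> = z}"
      by (rule measure_pmf.finite_measure_mono) auto
    then show ?thesis
      using True by (simp add: channel_def measure_le_0_iff)
  next
    case False
    have "measure p {\<omega>. (U \<omega> = u \<and> Z \<omega> = z \<and> Y \<omega> = y) \<and> X \<omega> = x} * measure p {\<omega>. X \<omega> = x \<and> Z \<omega> = z}
        = measure p {\<omega>. U \<omega> = u \<and> (X \<omega>, Z \<omega>) = (x, z) \<and> Y \<omega> = y} * measure p {\<omega>. (X \<omega>, Z \<omega>) = (x, z)}"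
      by (intro arg_cong2[where f = "(*)"] arg_cong2[where f = measure]) auto
    also have "\<dots> = measure p {\<omega>. U \<omega> = u \<and> (X \<omega>, Z \<omega>) = (x, z)} * measure p {\<omega>. (X \<omega>, Z \<omega>) = (x, z) \<and> Y \<omega> = y}"
      using assms unfolding markov_chain_given_def by (rule markov_chain_measure)
    also have "\<dots> = measure p {\<omega>. (U \<omega> = u \<and> Z \<omega> = z) \<and> X \<omega> = x} * (channel p X Y Z x y z * measure p {\<omega>. X \<omega> = x \<and> Z \<omega> = z})"
      unfolding channel_mult by (intro arg_cong2[where f = "(*)"] arg_cong2[where f = measure]) auto
    finally show ?thesis
      using False by simp
  qed
  have "ennreal (measure p {\<omega>. U \<omega> = u \<and> Z \<omega> = z \<and> Y \<omega> = y})
      = (\<integral>\<^sup>+x. ennreal (measure p {\<omega>. (U \<omega> = u \<and> Z \<omega> = z \<and> Y \<omega> = y) \<and> X \<omega> = x}) \<partial>count_space UNIV)"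
    by (rule nn_integral_prob_slices[symmetric])
  also have "\<dots> \<le> (\<integral>\<^sup>+x. ennreal (measure p {\<omega>. (U \<omega> = u \<and> Z \<omega> = z) \<and> X \<omega> = x})
      * (SUP x. ennreal (channel p X Y Z x y z)) \<partial>count_space UNIV)"
    unfolding factor by (intro nn_integral_mono) (auto simp: ennreal_mult intro!: mult_left_mono SUP_upper)
  also have "\<dots> = (\<integral>\<^sup>+x. ennreal (measure p {\<omega>. (U \<omega> = u \<and> Z \<omega> = z) \<and> X \<omega> = x}) \<partial>count_space UNIV)
      * (SUP x. ennreal (channel p X Y Z x y z))"
    by (rule nn_integral_multc) simp
  finally show ?thesis
    unfolding nn_integral_prob_slices .
qed

text \<open>For fixed \<open>z\<close> the factor \<open>P(u, z)\<close> is at most the success mass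
  of the blind MAP guess, and summing the remaining factor over \<open>y\<close> gives the sum of
  maxima at \<open>z\<close>. Replacing this by its supremum before summing over \<open>z\<close>
  bounds the average.\<close>

lemma guess_le_sum_max:
  assumes M: "markov_chain_given p U X Y Z" and "finite \<U>" "U ` set_pmf p \<subseteq> \<U>"
  shows "ennreal (measure p {\<omega>. U \<omega> = h (Y \<omega>) (Z \<omega>)})
    \<le> ennreal (measure p {\<omega>. U \<omega> = map_estimator p \<U> U Z (Z \<omega>)}) * sum_max p X Y Z"
proof -
  have "\<U> \<noteq> {}"
    using assms(3) set_pmf_not_empty[of p] by auto
  let ?m = "\<lambda>z. ennreal (measure p {\<omega>. U \<omega> = map_estimator p \<U> U Z z \<and> Z \<omega> = z})"
  have le_m: "ennreal (measure p {\<omega>. U \<omega> = u \<and> Z \<omega> = z}) \<le> ?m z" for u z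
  proof (cases "u \<in> \<U>")
    case True
    then show ?thesis
      by (intro ennreal_leI map_estimator_max assms \<open>\<U> \<noteq> {}\<close>)
  next
    case False
    then have "measure p {\<omega>. U \<omega> = u \<and> Z \<omega> = z} = 0"
      using assms(3) by (auto simp: measure_pmf_zero_iff)
    then show ?thesis by simp
  qed
  have z_slice: "ennreal (measure p {\<omega>. U \<omega> = h (Y \<omega>) (Z \<omega>) \<and> Z \<omega> = z}) \<le> ?m z * sum_max p X Y Z" for z
  proof -
    have "ennreal (measure p {\<omega>. U \<omega> = h (Y \<omega>) (Z \<omega>) \<and> Z \<omega> = z})
        = (\<integral>\<^sup>+y. ennreal (measure p {\<omega>. (U \<omega> = h (Y \<omega>) (Z \<omega>) \<and> Z \<omega> = z) \<and> Y \<omega> = y}) \<partial>count_space UNIV)"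
      by (rule nn_integral_prob_slices[symmetric])
    also have "\<dots> = (\<integral>\<^sup>+y. ennreal (measure p {\<omega>. U \<omega> = h y z \<and> Z \<omega> = z \<and> Y \<omega> = y}) \<partial>count_space UNIV)"
      by (intro nn_integral_cong arg_cong[where f = ennreal] arg_cong2[where f = measure]) auto
    also have "\<dots> \<le> (\<integral>\<^sup>+y. ?m z * (SUP x. ennreal (channel p X Y Z x y z)) \<partial>count_space UNIV)"
      by (intro nn_integral_mono order.trans[OF markov_chain_given_joint_le[OF M]] mult_right_mono le_m) simp
    also have "\<dots> = ?m z * sum_max_at p X Y Z z"
      unfolding sum_max_at_def by (rule nn_integral_cmult) simp
    also have "\<dots> \<le> ?m z * sum_max p X Y Z"
      by (intro mult_left_mono sum_max_at_le) simp
    finally show ?thesis .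
  qed
  have "ennreal (measure p {\<omega>. U \<omega> = h (Y \<omega>) (Z \<omega>)})
      = (\<integral>\<^sup>+z. ennreal (measure p {\<omega>. U \<omega> = h (Y \<omega>) (Z \<omega>) \<and> Z \<omega> = z}) \<partial>count_space UNIV)"
    by (rule nn_integral_prob_slices[symmetric])
  also have "\<dots> \<le> (\<integral>\<^sup>+z. ?m z * sum_max p X Y Z \<partial>count_space UNIV)"
    by (intro nn_integral_mono z_slice)
  also have "\<dots> = (\<integral>\<^sup>+z. ?m z \<partial>count_space UNIV) * sum_max p X Y Z"
    by (rule nn_integral_multc) simp
  finally show ?thesis
    unfolding guess_slices[where h = "map_estimator p \<U> U Z"] .
qed

text \<open>A maximum of nonnegative numbers is at most their sum, and each of the rows has sum at
  most 1.\<close>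

lemma sum_max_le_card:
  assumes "finite \<X>" "X ` set_pmf p \<subseteq> \<X>"
  shows "sum_max p X Y Z \<le> of_nat (card \<X>)"
  unfolding sum_max_def
proof (rule SUP_least)
  fix z
  have zero: "channel p X Y Z x y z = 0" if "x \<notin> \<X>" for x y
  proof -
    have "measure p {\<omega>. X \<omega> = x \<and> Z \<omega> = z} = 0"
      using assms that by (auto simp: measure_pmf_zero_iff)
    then show ?thesis
      by (simp add: channel_def)
  qed
  have le: "(SUP x. ennreal (channel p X Y Z x y z)) \<le> (\<Sum>x\<in>\<X>. ennreal (channel p X Y Z x y z))" for y
  proof (rule SUP_least)
    fix x
    show "ennreal (channel p X Y Z x y z) \<le> (\<Sum>x\<in>\<X>. ennreal (channel p X Y Z x y z))"
      using assms(1) member_le_sum[of x \<X> "\<lambda>x. ennreal (channel p X Y Z x y z)"]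
        zero[of x y]
      by (cases "x \<in> \<X>") auto
  qed
  have "sum_max_at p X Y Z z \<le> (\<integral>\<^sup>+y. (\<Sum>x\<in>\<X>. ennreal (channel p X Y Z x y z)) \<partial>count_space UNIV)"
    unfolding sum_max_at_def by (intro nn_integral_mono le)
  also have "\<dots> = (\<Sum>x\<in>\<X>. \<integral>\<^sup>+y. ennreal (channel p X Y Z x y z) \<partial>count_space UNIV)"
    by (rule nn_integral_sum) simp
  also have "\<dots> \<le> (\<Sum>x\<in>\<X>. 1)"
    unfolding channel_sum by (intro sum_mono) simp
  finally show "sum_max_at p X Y Z z \<le> of_nat (card \<X>)"
    by simp
qed

text \<open>Each maximum is at most 1, and it vanishes at outputs that never occur.\<close>

lemma sum_max_le_card_output:
  assumes "finite \<Y>" "Y ` set_pmf p \<subseteq> \<Y>"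
  shows "sum_max p X Y Z \<le> of_nat (card \<Y>)"
  unfolding sum_max_def
proof (rule SUP_least)
  fix z
  have "channel p X Y Z x y z \<le> indicator \<Y> y" for x y
  proof (cases "y \<in> \<Y>")
    case True
    then show ?thesis
      by (simp add: channel_le_1)
  next
    case False
    then have "measure p {\<omega>. X \<omega> = x \<and> Z \<omega> = z \<and> Y \<omega> = y} = 0"
      using assms(2) by (auto simp: measure_pmf_zero_iff)
    then show ?thesis
      by (simp add: channel_def)
  qed
  then have "ennreal (channel p X Y Z x y z) \<le> indicator \<Y> y" for x y
    using ennreal_leI by (metis ennreal_indicator)
  then have "sum_max_at p X Y Z z \<le> (\<integral>\<^sup>+y. indicator \<Y> y \<partial>count_space UNIV)"
    unfolding sum_max_at_def by (intro nn_integral_mono SUP_least)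
  then show "sum_max_at p X Y Z z \<le> of_nat (card \<Y>)"
    using assms(1) by simp
qed

text \<open>The maxima dominate the row of any input that is possible together with
  \<open>z\<close>, and that row has sum 1.\<close>

lemma sum_max_at_ge_1:
  assumes "z \<in> Z ` set_pmf p"
  shows "1 \<le> sum_max_at p X Y Z z"
proof -
  obtain \<omega> where \<omega>: "\<omega> \<in> set_pmf p" "z = Z \<omega>"
    using assms by blast
  then have "0 < measure p {\<omega>'. X \<omega>' = X \<omega> \<and> Z \<omega>' = z}"
    by (intro measure_pmf_posI) auto
  then have "1 = (\<integral>\<^sup>+y. ennreal (channel p X Y Z (X \<omega>) y z) \<partial>count_space UNIV)"
    by (simp add: channel_sum)
  also have "\<dots> \<le> sum_max_at p X Y Z z"
    unfolding sum_max_at_def by (intro nn_integral_mono SUP_upper) simp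
  finally show ?thesis .
qed

lemma sum_max_ge_1: "1 \<le> sum_max p X Y Z"
proof -
  obtain z where "z \<in> Z ` set_pmf p"
    using set_pmf_not_empty[of p] by blast
  then show ?thesis
    by (rule order.trans[OF sum_max_at_ge_1 sum_max_at_le])
qed

text \<open>Permits passage to the real logarithm: finiteness makes \<open>enn2real\<close>
  faithful, and the lower bound 1 stays clear of the default value of \<open>ln\<close> at
  0.\<close>

lemma enn2real_sum_max:
  assumes "finite (X ` set_pmf p)"
  shows "ennreal (enn2real (sum_max p X Y Z)) = sum_max p X Y Z" "1 \<le> enn2real (sum_max p X Y Z)"
proof -
  have "sum_max p X Y Z < \<top>"
    using sum_max_le_card[OF assms order_refl, of Y Z] by (simp add: le_less_trans of_nat_less_top)
  then show *: "ennreal (enn2real (sum_max p X Y Z)) = sum_max p X Y Z"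
    by simp
  show "1 \<le> enn2real (sum_max p X Y Z)"
    using sum_max_ge_1[of p X Y Z] by (subst (asm) *[symmetric]) simp
qed

section \<open>Closed form of the conditional maximal leakage\<close>

definition attach :: "'s pmf \<Rightarrow> ('s \<Rightarrow> 'u pmf) \<Rightarrow> ('u \<times> 's) pmf" where
  "attach p \<kappa> = bind_pmf p (\<lambda>s. map_pmf (\<lambda>u. (u, s)) (\<kappa> s))"

lemma map_snd_attach: "map_pmf snd (attach p \<kappa>) = p"
  by (simp add: attach_def map_bind_pmf pmf.map_comp o_def map_pmf_const bind_return_pmf')

lemma emeasure_attach_graph:
  "emeasure (attach p \<kappa>) {\<omega>. P (snd \<omega>) \<and> fst \<omega> = h (snd \<omega>)}
    = (\<integral>\<^sup>+s. ennreal (pmf (\<kappa> s) (h s)) * indicator {s. P s} s \<partial>measure_pmf p)"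
proof -
  have "emeasure (map_pmf (\<lambda>u. (u, s)) (\<kappa> s)) {\<omega>. P (snd \<omega>) \<and> fst \<omega> = h (snd \<omega>)}
      = ennreal (pmf (\<kappa> s) (h s)) * indicator {s. P s} s" for s
  proof -
    have "(\<lambda>u. (u, s)) -` {\<omega>. P (snd \<omega>) \<and> fst \<omega> = h (snd \<omega>)} = (if P s then {h s} else {})"
      by auto
    then show ?thesis
      by (simp add: emeasure_pmf_single)
  qed
  then show ?thesis
    by (simp add: attach_def)
qed

lemma measure_attach:
  "measure (attach p (\<lambda>s. \<kappa> (f s))) {\<omega>. fst \<omega> = u \<and> f (snd \<omega>) = b \<and> P (snd \<omega>)}
    = pmf (\<kappa> b) u * measure p {s. f s = b \<and> P s}"
proof -
  have "emeasure (attach p (\<lambda>s. \<kappa> (f s))) {\<omega>. fst \<omega> = u \<and> f (snd \<omega>) = b \<and> P (snd \<omega>)}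
      = emeasure (attach p (\<lambda>s. \<kappa> (f s))) {\<omega>. (f (snd \<omega>) = b \<and> P (snd \<omega>)) \<and> fst \<omega> = (\<lambda>_. u) (snd \<omega>)}"
    by (intro arg_cong2[where f = emeasure]) auto
  also have "\<dots> = (\<integral>\<^sup>+s. ennreal (pmf (\<kappa> b) u) * indicator {s. f s = b \<and> P s} s \<partial>measure_pmf p)"
    by (subst emeasure_attach_graph) (auto intro!: nn_integral_cong simp: indicator_def)
  also have "\<dots> = ennreal (pmf (\<kappa> b) u * measure p {s. f s = b \<and> P s})"
    by (simp add: nn_integral_cmult measure_pmf.emeasure_eq_measure ennreal_mult)
  finally show ?thesis
    by (simp add: measure_pmf.emeasure_eq_measure)
qed

text \<open>The label is drawn from a kernel that sees only \<open>f s\<close>, so given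
  \<open>f s\<close> it is independent of everything else. With \<open>f = (X, Z)\<close> this makes
  the constructed \<open>U\<close> admissible for the conditional leakage.\<close>

lemma markov_chain_attach:
  "markov_chain (attach p (\<lambda>s. \<kappa> (f s))) fst (\<lambda>\<omega>. f (snd \<omega>)) (\<lambda>\<omega>. g (snd \<omega>))"
proof (rule markov_chainI)
  fix a b c
  let ?q = "attach p (\<lambda>s. \<kappa> (f s))"
  have *: "measure ?q {\<omega>. P (snd \<omega>)} = measure p {s. P s}" for P
    using arg_cong[OF map_snd_attach[of p "\<lambda>s. \<kappa> (f s)"], of "\<lambda>r. measure r {s. P s}"] by (simp add: vimage_def)
  show "measure ?q {\<omega>. fst \<omega> = a \<and> f (snd \<omega>) = b \<and> g (snd \<omega>) = c} * measure ?q {\<omega>. f (snd \<omega>) = b}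
      = measure ?q {\<omega>. fst \<omega> = a \<and> f (snd \<omega>) = b} * measure ?q {\<omega>. f (snd \<omega>) = b \<and> g (snd \<omega>) = c}"
    using measure_attach[of p \<kappa> f a b "\<lambda>s. g s = c"] measure_attach[of p \<kappa> f a b "\<lambda>_. True"]
      *[of "\<lambda>s. f s = b"] *[of "\<lambda>s. f s = b \<and> g s = c"]
    by simp
qed

text \<open>
  The optimal \<open>U\<close> for a given \<open>z0\<close>. Let \<open>c\<close> be the least positive \<open>P(x, z0)\<close>. When \<open>Z = z0\<close>, the
  variable \<open>U\<close> names \<open>X\<close> with probability \<open>c / P(X, z0)\<close>, so that no name is more likely than another;
  otherwise it is uniform on \<open>M\<close> further symbols. Without \<open>Y\<close>, a guess \<open>g(Z)\<close> is thus correct with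
  probability at most \<open>c + 1/M\<close>, while \<open>h(y)\<close>, the name of the \<open>x\<close> maximising \<open>P(y|x, z0)\<close>, achieves
  \<open>c\<close> times the sum of maxima.
\<close>

lemma shattering:
  fixes p :: "'s pmf" and X :: "'s \<Rightarrow> 'x" and Y :: "'s \<Rightarrow> 'y" and Z :: "'s \<Rightarrow> 'z"
  assumes fin: "finite (X ` set_pmf p)" and z0: "z0 \<in> Z ` set_pmf p"
  shows "\<exists>c>0. \<forall>M>0. \<exists>(\<kappa> :: 'x \<times> 'z \<Rightarrow> nat pmf) N h.
    (\<forall>s. set_pmf (\<kappa> s) \<subseteq> {..<N}) \<and>
    (\<forall>g. measure (attach p (\<lambda>s. \<kappa> (X s, Z s))) {\<omega>. fst \<omega> = g (Z (snd \<omega>))} \<le> c + 1 / real M) \<and>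
    ennreal c * sum_max_at p X Y Z z0 \<le>
      ennreal (measure (attach p (\<lambda>s. \<kappa> (X s, Z s))) {\<omega>. fst \<omega> = h (Y (snd \<omega>))})"
proof -
  define pz where "pz x = measure p {s. X s = x \<and> Z s = z0}" for x
  define T where "T = {x \<in> X ` set_pmf p. pz x > 0}"
  define c where "c = Min (pz ` T)"
  have finT: "finite T"
    using fin by (simp add: T_def)
  have pz0: "pz x = 0" if "x \<notin> T" for x
  proof (cases "x \<in> X ` set_pmf p")
    case True
    then show ?thesis
      using that by (simp add: T_def pz_def less_le)
  next
    case False
    then show ?thesis
      by (auto simp: pz_def measure_pmf_zero_iff)
  qed
  obtain s0 where s0: "s0 \<in> set_pmf p" "Z s0 = z0"
    using z0 by blast
  then have "pz (X s0) > 0"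
    unfolding pz_def by (intro measure_pmf_posI) auto
  then have neT: "T \<noteq> {}"
    using pz0 by fastforce
  have c_pos: "c > 0"
    unfolding c_def using finT neT by (simp add: T_def)
  have c_le: "c \<le> pz x" if "x \<in> T" for x
    unfolding c_def using finT that by simp
  obtain e :: "'x \<Rightarrow> nat" and n where e: "inj_on e T" "e ` T \<subseteq> {..<n}"
    using finite_imp_inj_to_nat_seg[OF finT] by (metis lessThan_def order_refl)
  define t where "t s = (if snd s = z0 \<and> fst s \<in> T then c / pz (fst s) else 0)" for s
  have t01: "0 \<le> t s" "t s \<le> 1" for s
    using c_pos c_le[of "fst s"] by (auto simp: t_def T_def divide_le_eq_1)
  have "\<exists>x\<in>T. \<forall>x'\<in>T. channel p X Y Z x' y z0 \<le> channel p X Y Z x y z0" for y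
  proof -
    obtain x where "x \<in> T" "(MAX x\<in>T. channel p X Y Z x y z0) = channel p X Y Z x y z0"
      using obtains_MAX[OF finT neT] .
    then show ?thesis
      using finT by (intro bexI[of _ x]) (auto dest: sym)
  qed
  then have "\<forall>y. \<exists>x. x \<in> T \<and> (\<forall>x'\<in>T. channel p X Y Z x' y z0 \<le> channel p X Y Z x y z0)"
    by blast
  from choice[OF this] obtain xs where xs: "\<And>y. xs y \<in> T"
      "\<And>y x'. x' \<in> T \<Longrightarrow> channel p X Y Z x' y z0 \<le> channel p X Y Z (xs y) y z0"
    by blast
  \<comment> \<open>Inputs outside \<open>T\<close> are impossible together with \<open>z0\<close>,
    so their zero rows do not affect the supremum, and the maximiser over the finite set
    \<open>T\<close> suffices.\<close>
  have sup_xs: "(SUP x. ennreal (channel p X Y Z x y z0)) \<le> ennreal (channel p X Y Z (xs y) y z0)" for y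
  proof (rule SUP_least)
    fix x
    show "ennreal (channel p X Y Z x y z0) \<le> ennreal (channel p X Y Z (xs y) y z0)"
    proof (cases "x \<in> T")
      case False
      then show ?thesis
        using pz0[of x] by (simp add: channel_def pz_def)
    qed (simp add: xs)
  qed
  have "\<exists>(\<kappa> :: 'x \<times> 'z \<Rightarrow> nat pmf) N h.
      (\<forall>s. set_pmf (\<kappa> s) \<subseteq> {..<N}) \<and>
      (\<forall>g. measure (attach p (\<lambda>s. \<kappa> (X s, Z s))) {\<omega>. fst \<omega> = g (Z (snd \<omega>))} \<le> c + 1 / real M) \<and>
      ennreal c * sum_max_at p X Y Z z0 \<le>
        ennreal (measure (attach p (\<lambda>s. \<kappa> (X s, Z s))) {\<omega>. fst \<omega> = h (Y (snd \<omega>))})"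
    if M: "M > 0" for M :: nat
  proof -
    \<comment> \<open>Names lie below \<open>n\<close> and the \<open>M\<close> further symbols
      start at \<open>n\<close>, so the two kinds are disjoint. For inputs outside \<open>T\<close>
      the first branch has weight 0; its default \<open>n\<close> keeps the support inside
      \<open>{..<n + M}\<close>.\<close>
    define \<kappa> :: "'x \<times> 'z \<Rightarrow> nat pmf" where "\<kappa> s = bind_pmf (bernoulli_pmf (t s))
      (\<lambda>b. if b then return_pmf (if fst s \<in> T then e (fst s) else n) else pmf_of_set {n..<n + M})" for s
    let ?q = "attach p (\<lambda>s. \<kappa> (X s, Z s))"
    have pmf_\<kappa>: "pmf (\<kappa> s) u = t s * indicator {e (fst s)} u + (1 - t s) * (indicator {n..<n + M} u / real M)" for s u
      using M t01[of s] by (auto simp: \<kappa>_def pmf_bind t_def indicator_def)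
    have supp: "set_pmf (\<kappa> s) \<subseteq> {..<n + M}" for s
      using M e(2) by (auto simp: \<kappa>_def split: if_splits)
    have guess: "measure ?q {\<omega>. fst \<omega> = g (Z (snd \<omega>))} \<le> c + 1 / real M" for g
    proof -
      \<comment> \<open>Given \<open>Z = z0\<close> the guess is the single symbol
        \<open>g z0\<close>, and \<open>x0\<close> is the one element of \<open>T\<close> that it
        can name. If it names none, \<open>x0\<close> is arbitrary and its term in the bound is
        merely nonnegative.\<close>
      define x0 where "x0 = (SOME x. x \<in> T \<and> e x = g z0)"
      have x0: "x0 \<in> T \<and> e x0 = g z0" if "x \<in> T" "e x = g z0" for x
        unfolding x0_def using that by (rule someI[of "\<lambda>x. x \<in> T \<and> e x = g z0", OF conjI])
      have pt: "ennreal (pmf (\<kappa> (X s, Z s)) (g (Z s)))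
          \<le> ennreal (c / pz x0) * indicator {s. X s = x0 \<and> Z s = z0} s + ennreal (1 / real M)" for s
      proof -
        have "pmf (\<kappa> (X s, Z s)) (g (Z s)) \<le> t (X s, Z s) * indicator {e (X s)} (g (Z s)) + 1 / real M"
        proof -
          have "(1 - t (X s, Z s)) * (indicator {n..<n + M} (g (Z s)) / real M) \<le> 1 * (1 / real M)"
            using t01[of "(X s, Z s)"] by (intro mult_mono divide_right_mono) (auto simp: indicator_def)
          then show ?thesis
            by (simp add: pmf_\<kappa>)
        qed
        also have "t (X s, Z s) * indicator {e (X s)} (g (Z s)) \<le> c / pz x0 * indicator {s. X s = x0 \<and> Z s = z0} s"
        proof (cases "X s \<in> T \<and> Z s = z0 \<and> g z0 = e (X s)")
          case True
          then have "x0 \<in> T \<and> e x0 = g z0"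
            using x0[of "X s"] by simp
          then have "x0 = X s"
            using True e(1) by (metis inj_onD)
          then show ?thesis
            using True by (simp add: t_def)
        next
          case False
          then have "t (X s, Z s) * indicator {e (X s)} (g (Z s)) = 0"
            by (auto simp: t_def indicator_def)
          also have "\<dots> \<le> c / pz x0 * indicator {s. X s = x0 \<and> Z s = z0} s"
            using c_pos by (simp add: pz_def)
          finally show ?thesis .
        qed
        finally have "ennreal (pmf (\<kappa> (X s, Z s)) (g (Z s)))
            \<le> ennreal (c / pz x0 * indicator {s. X s = x0 \<and> Z s = z0} s + 1 / real M)"
          by (intro ennreal_leI) simp
        also have "\<dots> = ennreal (c / pz x0) * indicator {s. X s = x0 \<and> Z s = z0} s + ennreal (1 / real M)"
          using c_pos by (simp add: pz_def indicator_def)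
        finally show ?thesis .
      qed
      have "emeasure ?q {\<omega>. fst \<omega> = g (Z (snd \<omega>))} = (\<integral>\<^sup>+s. ennreal (pmf (\<kappa> (X s, Z s)) (g (Z s))) \<partial>measure_pmf p)"
        using emeasure_attach_graph[of p "\<lambda>s. \<kappa> (X s, Z s)" "\<lambda>_. True" "\<lambda>s. g (Z s)"] by simp
      also have "\<dots> \<le> (\<integral>\<^sup>+s. ennreal (c / pz x0) * indicator {s. X s = x0 \<and> Z s = z0} s + ennreal (1 / real M) \<partial>measure_pmf p)"
        by (intro nn_integral_mono pt)
      also have "\<dots> = ennreal (c / pz x0) * ennreal (pz x0) + ennreal (1 / real M)"
        by (simp add: nn_integral_add nn_integral_cmult measure_pmf.emeasure_eq_measure pz_def)
      \<comment> \<open>Only an inequality, since an arbitrary \<open>x0\<close> may have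
        \<open>pz x0 = 0\<close>.\<close>
      also have "ennreal (c / pz x0) * ennreal (pz x0) \<le> ennreal c"
        using c_pos by (auto simp: ennreal_mult[symmetric] pz_def)
      finally show ?thesis
        using c_pos by (simp add: measure_pmf.emeasure_eq_measure ennreal_plus[symmetric] del: ennreal_plus)
    qed
    have "ennreal c * sum_max_at p X Y Z z0
        = (\<integral>\<^sup>+y. ennreal c * (SUP x. ennreal (channel p X Y Z x y z0)) \<partial>count_space UNIV)"
      unfolding sum_max_at_def by (rule nn_integral_cmult[symmetric]) simp
    also have "\<dots> \<le> (\<integral>\<^sup>+y. ennreal (measure ?q {\<omega>. fst \<omega> = e (xs y) \<and> Y (snd \<omega>) = y}) \<partial>count_space UNIV)"
    proof (rule nn_integral_mono)
      fix y
      have pos: "pz (xs y) > 0"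
        using xs(1)[of y] by (simp add: T_def)
      have "ennreal c * (SUP x. ennreal (channel p X Y Z x y z0)) \<le> ennreal c * ennreal (channel p X Y Z (xs y) y z0)"
        by (intro mult_left_mono sup_xs) simp
      \<comment> \<open>The weight \<open>c / P(x, z0)\<close> cancels the input probability:
        \<open>c P(y|x, z0)\<close> is exactly the probability that \<open>X = x\<close>,
        \<open>Z = z0\<close>, \<open>Y = y\<close> and the naming branch is taken.\<close>
      also have "\<dots> = ennreal (t (xs y, z0) * measure p {s. X s = xs y \<and> Z s = z0 \<and> Y s = y})"
        using c_pos pos xs(1)[of y] unfolding channel_mult[symmetric]
        by (simp add: ennreal_mult[symmetric] t_def pz_def[symmetric])
      also have "\<dots> \<le> ennreal (pmf (\<kappa> (xs y, z0)) (e (xs y)) * measure p {s. (X s, Z s) = (xs y, z0) \<and> Y s = y})"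
        using t01[of "(xs y, z0)"] by (intro ennreal_leI mult_mono) (auto simp: pmf_\<kappa>)
      also have "\<dots> = ennreal (measure ?q {\<omega>. fst \<omega> = e (xs y) \<and> (X (snd \<omega>), Z (snd \<omega>)) = (xs y, z0) \<and> Y (snd \<omega>) = y})"
        using measure_attach[of p \<kappa> "\<lambda>s. (X s, Z s)" "e (xs y)" "(xs y, z0)" "\<lambda>s. Y s = y"] by simp
      also have "\<dots> \<le> ennreal (measure ?q {\<omega>. fst \<omega> = e (xs y) \<and> Y (snd \<omega>) = y})"
        by (intro ennreal_leI measure_pmf.finite_measure_mono) auto
      finally show "ennreal c * (SUP x. ennreal (channel p X Y Z x y z0))
          \<le> ennreal (measure ?q {\<omega>. fst \<omega> = e (xs y) \<and> Y (snd \<omega>) = y})" .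
    qed
    also have "\<dots> = ennreal (measure ?q {\<omega>. fst \<omega> = e (xs (Y (snd \<omega>)))})"
      by (rule guess_slices[where h = "\<lambda>y. e (xs y)"])
    finally show ?thesis
      by (intro exI[of _ \<kappa>] exI[of _ "n + M"] exI[of _ "\<lambda>y. e (xs y)"] conjI allI supp guess)
  qed
  then show ?thesis
    using c_pos by blast
qed

section \<open>The two bounds for the conditional leakage\<close>

lemma elog_pos: "0 < x \<Longrightarrow> elog x = ereal (ln x)"
  by (simp add: elog_def)

lemma elog_mono: "0 \<le> x \<Longrightarrow> x \<le> y \<Longrightarrow> elog x \<le> elog y"
  by (auto simp: elog_def)

text \<open>Projections in place of tuple patterns: the marginal condition becomes a statement about
  \<open>map_pmf snd q\<close>, the form in which \<open>map_snd_attach\<close> supplies it.\<close>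

lemma cond_max_leakage_eq_SUP:
  "cond_max_leakage p X Y Z =
     (SUP (\<U>, q :: (nat \<times> _) pmf) \<in> {(\<U> :: nat set, q). finite \<U> \<and> fst ` set_pmf q \<subseteq> \<U> \<and>
        map_pmf snd q = map_pmf (\<lambda>\<omega>. (X \<omega>, Y \<omega>, Z \<omega>)) p \<and>
        markov_chain_given q fst (\<lambda>\<omega>. fst (snd \<omega>)) (\<lambda>\<omega>. fst (snd (snd \<omega>))) (\<lambda>\<omega>. snd (snd (snd \<omega>)))}.
      elog (measure (measure_pmf q) {\<omega>. fst \<omega> = map_estimator q \<U> fst (\<lambda>\<omega>. (fst (snd (snd \<omega>)), snd (snd (snd \<omega>))))
                               (fst (snd (snd \<omega>)), snd (snd (snd \<omega>)))} /
            measure (measure_pmf q) {\<omega>. fst \<omega> = map_estimator q \<U> fst (\<lambda>\<omega>. snd (snd (snd \<omega>))) (snd (snd (snd \<omega>)))}))"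
proof -
  have proj: "(\<lambda>(u, x, y, z). u) = fst" "(\<lambda>(u, x, y, z). x) = (\<lambda>\<omega>. fst (snd \<omega>))"
    "(\<lambda>(u, x, y, z). y) = (\<lambda>\<omega>. fst (snd (snd \<omega>)))" "(\<lambda>(u, x, y, z). z) = (\<lambda>\<omega>. snd (snd (snd \<omega>)))"
    by (auto simp: fun_eq_iff)
  have snd_eq: "(\<lambda>\<omega>. (fst (snd \<omega>), fst (snd (snd \<omega>)), snd (snd (snd \<omega>)))) = snd"
    by (auto simp: fun_eq_iff)
  show ?thesis
    unfolding cond_max_leakage_def Let_def proj snd_eq set_map_pmf by simp
qed

lemma cond_max_leakage_le_sum_max:
  assumes "finite (X ` set_pmf p)"
  shows "cond_max_leakage p X Y Z \<le> ereal (ln (enn2real (sum_max p X Y Z)))"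
  unfolding cond_max_leakage_eq_SUP
proof (rule SUP_least, clarify)
  fix \<U> :: "nat set" and q
  let ?X = "\<lambda>\<omega>. fst (snd \<omega>)" and ?Y = "\<lambda>\<omega>. fst (snd (snd \<omega>))" and ?Z = "\<lambda>\<omega>. snd (snd (snd \<omega>))"
  assume \<U>: "finite \<U>" "fst ` set_pmf q \<subseteq> \<U>"
    and q: "map_pmf snd q = map_pmf (\<lambda>\<omega>. (X \<omega>, Y \<omega>, Z \<omega>)) p"
    and M: "markov_chain_given q fst ?X ?Y ?Z"
  define num where "num = measure q {\<omega>. fst \<omega> = map_estimator q \<U> fst (\<lambda>\<omega>. (?Y \<omega>, ?Z \<omega>)) (?Y \<omega>, ?Z \<omega>)}"
  define den where "den = measure q {\<omega>. fst \<omega> = map_estimator q \<U> fst ?Z (?Z \<omega>)}"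
  let ?k = "enn2real (sum_max p X Y Z)"
  \<comment> \<open>The extension \<open>q\<close> has the same law of the triple as
    \<open>p\<close>, hence the same sum of maxima.\<close>
  have k: "sum_max q ?X ?Y ?Z = ennreal ?k" "1 \<le> ?k"
    using enn2real_sum_max[OF assms, of Y Z] q by (auto intro!: sum_max_cong_joint simp: case_prod_beta)
  have den: "0 < den"
    unfolding den_def by (rule map_estimator_prob_pos[OF \<U>])
  have "ennreal num \<le> ennreal den * ennreal ?k"
    unfolding num_def den_def k(1)[symmetric]
    using guess_le_sum_max[OF M \<U>, of "\<lambda>y z. map_estimator q \<U> fst (\<lambda>\<omega>. (?Y \<omega>, ?Z \<omega>)) (y, z)"] .
  then have "num / den \<le> ?k"
    using den k(2) by (simp add: ennreal_mult[symmetric] divide_le_eq mult.commute)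
  moreover have "0 \<le> num / den"
    by (simp add: num_def den_def)
  ultimately have "elog (num / den) \<le> elog ?k"
    by (rule elog_mono[rotated])
  then show "elog (num / den) \<le> ereal (ln ?k)"
    using k(2) by (simp add: elog_pos)
qed

text \<open>With \<open>d\<close> the sum of maxima at \<open>z\<close>, the constructed
  \<open>U\<close> has ratio at least \<open>c d / (c + 1/M)\<close>. This tends to \<open>d\<close>
  as \<open>M\<close> grows, while \<open>c\<close> stays fixed.\<close>

lemma ln_sum_max_at_le_cond_max_leakage:
  assumes fin: "finite (X ` set_pmf p)" and z: "z \<in> Z ` set_pmf p"
  shows "ereal (ln (enn2real (sum_max_at p X Y Z z))) \<le> cond_max_leakage p X Y Z"
proof -
  let ?X = "\<lambda>s. fst s" and ?Y = "\<lambda>s. fst (snd s)" and ?Z = "\<lambda>s. snd (snd s)"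
  \<comment> \<open>An admissible \<open>q\<close> lives on tuples \<open>(u, x, y, z)\<close>, so
    the label is attached to the law of the triple instead of to \<open>p\<close>.\<close>
  define J where "J = map_pmf (\<lambda>\<omega>. (X \<omega>, Y \<omega>, Z \<omega>)) p"
  have XJ: "?X ` set_pmf J = X ` set_pmf p" and ZJ: "?Z ` set_pmf J = Z ` set_pmf p"
    by (auto simp: J_def image_image)
  have at_eq: "sum_max_at J ?X ?Y ?Z = sum_max_at p X Y Z"
    by (rule sum_max_cong_joint) (simp add: J_def pmf.map_comp o_def)
  define d where "d = enn2real (sum_max_at p X Y Z z)"
  have "sum_max_at p X Y Z z < \<top>"
    using sum_max_at_le[of p X Y Z z] enn2real_sum_max(1)[OF fin, of Y Z]
    by (metis ennreal_less_top le_less_trans)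
  then have d: "sum_max_at p X Y Z z = ennreal d"
    by (simp add: d_def)
  have d1: "1 \<le> d"
    using sum_max_at_ge_1[OF z, of X Y] by (simp add: d ennreal_ge_1)
  obtain c where c: "c > 0" and shatter: "\<And>M. M > 0 \<Longrightarrow> \<exists>(\<kappa> :: _ \<Rightarrow> nat pmf) N h.
    (\<forall>s. set_pmf (\<kappa> s) \<subseteq> {..<N}) \<and>
    (\<forall>g. measure (attach J (\<lambda>s. \<kappa> (?X s, ?Z s))) {\<omega>. fst \<omega> = g (?Z (snd \<omega>))} \<le> c + 1 / real M) \<and>
    ennreal c * sum_max_at J ?X ?Y ?Z z \<le>
      ennreal (measure (attach J (\<lambda>s. \<kappa> (?X s, ?Z s))) {\<omega>. fst \<omega> = h (?Y (snd \<omega>))})"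
    using shattering[of ?X J z ?Z ?Y] fin z unfolding XJ ZJ by blast
  have approx: "ereal (ln (c * d / (c + 1 / real M))) \<le> cond_max_leakage p X Y Z" if M: "M > 0" for M :: nat
  proof -
    obtain \<kappa> :: "_ \<Rightarrow> nat pmf" and N h where
      \<kappa>: "\<And>s. set_pmf (\<kappa> s) \<subseteq> {..<N}" and
      den_le: "\<And>g. measure (attach J (\<lambda>s. \<kappa> (?X s, ?Z s))) {\<omega>. fst \<omega> = g (?Z (snd \<omega>))} \<le> c + 1 / real M" and
      num_ge: "ennreal c * ennreal d \<le>
        ennreal (measure (attach J (\<lambda>s. \<kappa> (?X s, ?Z s))) {\<omega>. fst \<omega> = h (?Y (snd \<omega>))})"
      using shatter[OF M] unfolding at_eq d by blast
    define q where "q = attach J (\<lambda>s. \<kappa> (?X s, ?Z s))"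
    have \<U>: "finite {..<N}" "fst ` set_pmf q \<subseteq> {..<N}"
      by (auto simp: q_def attach_def dest!: subsetD[OF \<kappa>])
    define num where "num = measure q {\<omega>. fst \<omega> = map_estimator q {..<N} fst
      (\<lambda>\<omega>. (fst (snd (snd \<omega>)), snd (snd (snd \<omega>)))) (fst (snd (snd \<omega>)), snd (snd (snd \<omega>)))}"
    define den where "den = measure q {\<omega>. fst \<omega> = map_estimator q {..<N} fst
      (\<lambda>\<omega>. snd (snd (snd \<omega>))) (snd (snd (snd \<omega>)))}"
    have mem: "({..<N}, q) \<in> {(\<U> :: nat set, q). finite \<U> \<and> fst ` set_pmf q \<subseteq> \<U> \<and>
        map_pmf snd q = map_pmf (\<lambda>\<omega>. (X \<omega>, Y \<omega>, Z \<omega>)) p \<and>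
        markov_chain_given q fst (\<lambda>\<omega>. fst (snd \<omega>)) (\<lambda>\<omega>. fst (snd (snd \<omega>))) (\<lambda>\<omega>. snd (snd (snd \<omega>)))}"
      using \<U> markov_chain_attach[of J \<kappa> "\<lambda>s. (?X s, ?Z s)" ?Y]
      by (simp add: q_def map_snd_attach markov_chain_given_def) (simp add: J_def)
    have le: "elog (num / den) \<le> cond_max_leakage p X Y Z"
      unfolding cond_max_leakage_eq_SUP num_def den_def by (rule SUP_upper2[OF mem]) simp
    have "0 < den"
      unfolding den_def by (rule map_estimator_prob_pos[OF \<U>])
    have "den \<le> c + 1 / real M"
      unfolding den_def q_def by (rule den_le)
    \<comment> \<open>Naming the best input for the observed \<open>y\<close> is one strategy among
      those that the MAP estimator dominates; the denominator, conversely, is a guess of the form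
      \<open>g(Z)\<close> and obeys the uniform bound.\<close>
    have "c * d \<le> measure q {\<omega>. fst \<omega> = h (?Y (snd \<omega>))}"
      using num_ge c d1 by (simp add: ennreal_mult[symmetric] q_def)
    also have "\<dots> \<le> num"
      unfolding num_def
      using guess_le_map_estimator[OF \<U>, of "\<lambda>s. h (fst s)" "\<lambda>\<omega>. (fst (snd (snd \<omega>)), snd (snd (snd \<omega>)))"] by simp
    finally have "c * d / (c + 1 / real M) \<le> num / den"
      using \<open>0 < den\<close> \<open>den \<le> c + 1 / real M\<close> c d1 by (intro frac_le) (auto simp: num_def)
    moreover have "0 < c * d / (c + 1 / real M)"
      using c d1 by (intro divide_pos_pos add_pos_nonneg) auto
    ultimately have "ereal (ln (c * d / (c + 1 / real M))) \<le> elog (num / den)"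
      by (simp only: elog_pos[symmetric] elog_mono less_imp_le)
    then show ?thesis
      using le by simp
  qed
  \<comment> \<open>The bound is available from \<open>M = 1\<close> on, which is enough for the
    limit.\<close>
  have "(\<lambda>M. ereal (ln (c * d / (c + 1 / real M)))) \<longlonglongrightarrow> ereal (ln (c * d / (c + 0)))"
    using c d1 by (intro tendsto_intros lim_1_over_n) auto
  then have "ereal (ln (c * d / (c + 0))) \<le> cond_max_leakage p X Y Z"
    by (rule LIMSEQ_le_const2) (use approx in \<open>auto intro!: exI[of _ 1]\<close>)
  then show ?thesis
    using c by (simp add: d_def[symmetric])
qed

text \<open>For the lower bound a best \<open>z\<close> may fail to exist when \<open>Z\<close> has
  infinite support. Hence the sum at every \<open>z\<close> is bounded by the exponential of the
  leakage, and the supremum is taken afterwards.\<close>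

lemma cond_max_leakage_eq:
  assumes fin: "finite (X ` set_pmf p)"
  shows "cond_max_leakage p X Y Z = ereal (ln (enn2real (sum_max p X Y Z)))"
proof (rule antisym)
  show "ereal (ln (enn2real (sum_max p X Y Z))) \<le> cond_max_leakage p X Y Z"
  proof (cases "cond_max_leakage p X Y Z")
    case (real l)
    have "sum_max_at p X Y Z z \<le> ennreal (exp l)" for z
    proof (cases "z \<in> Z ` set_pmf p")
      case True
      have fin_at: "sum_max_at p X Y Z z < \<top>"
        using sum_max_at_le[of p X Y Z z] enn2real_sum_max(1)[OF fin, of Y Z]
        by (metis ennreal_less_top le_less_trans)
      have "1 \<le> enn2real (sum_max_at p X Y Z z)"
        using sum_max_at_ge_1[OF True, of X Y] fin_at
        by (metis ennreal_1 ennreal_enn2real enn2real_nonneg ennreal_le_iff)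
      moreover have "ln (enn2real (sum_max_at p X Y Z z)) \<le> l"
        using ln_sum_max_at_le_cond_max_leakage[OF fin True, of Y] real by simp
      ultimately have "enn2real (sum_max_at p X Y Z z) \<le> exp l"
        by (metis exp_le_cancel_iff exp_ln less_le_trans zero_less_one)
      then show ?thesis
        using fin_at by (metis ennreal_enn2real ennreal_leI)
    next
      case False
      then have "channel p X Y Z x y z = 0" for x y
        by (auto simp: channel_def measure_pmf_zero_iff)
      then show ?thesis
        by (simp add: sum_max_at_def)
    qed
    then have "sum_max p X Y Z \<le> ennreal (exp l)"
      unfolding sum_max_def by (intro SUP_least)
    then have "enn2real (sum_max p X Y Z) \<le> exp l"
      by (simp add: enn2real_leI)
    then show ?thesis
      using enn2real_sum_max(2)[OF fin, of Y Z] real by (simp add: ln_le_cancel_iff[symmetric] del: ln_le_cancel_iff)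
  next
    case MInf
    obtain z where "z \<in> Z ` set_pmf p"
      using set_pmf_not_empty[of p] by blast
    then show ?thesis
      using ln_sum_max_at_le_cond_max_leakage[OF fin, of z Z Y] MInf by simp
  qed simp
qed (rule cond_max_leakage_le_sum_max[OF fin])

section \<open>Closed form of the maximal leakage\<close>

text \<open>Sum the product identity over all values of \<open>A\<close> that satisfy
  \<open>Q\<close>. This extracts a statement about \<open>U\<close> from the chain whose first
  variable is the pair \<open>(U, X)\<close>.\<close>

lemma markov_chain_event:
  assumes "markov_chain p A B C"
  shows "measure p {\<omega>. Q (A \<omega>) \<and> B \<omega> = b \<and> C \<omega> = c} * measure p {\<omega>. B \<omega> = b}
    = measure p {\<omega>. Q (A \<omega>) \<and> B \<omega> = b} * measure p {\<omega>. B \<omega> = b \<and> C \<omega> = c}"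
proof -
  have slice: "measure p {\<omega>. (Q (A \<omega>) \<and> B \<omega> = b \<and> C \<omega> = c) \<and> A \<omega> = a} * measure p {\<omega>. B \<omega> = b}
      = measure p {\<omega>. (Q (A \<omega>) \<and> B \<omega> = b) \<and> A \<omega> = a} * measure p {\<omega>. B \<omega> = b \<and> C \<omega> = c}" for a
  proof (cases "Q a")
    case True
    then have "{\<omega>. (Q (A \<omega>) \<and> B \<omega> = b \<and> C \<omega> = c) \<and> A \<omega> = a} = {\<omega>. A \<omega> = a \<and> B \<omega> = b \<and> C \<omega> = c}"
      "{\<omega>. (Q (A \<omega>) \<and> B \<omega> = b) \<and> A \<omega> = a} = {\<omega>. A \<omega> = a \<and> B \<omega> = b}"
      by auto
    then show ?thesis
      using markov_chain_measure[OF assms] by simp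
  next
    case False
    then have "{\<omega>. (Q (A \<omega>) \<and> B \<omega> = b \<and> C \<omega> = c) \<and> A \<omega> = a} = {}" "{\<omega>. (Q (A \<omega>) \<and> B \<omega> = b) \<and> A \<omega> = a} = {}"
      by auto
    then show ?thesis by (simp only: measure_empty mult_zero_left)
  qed
  have "ennreal (measure p {\<omega>. Q (A \<omega>) \<and> B \<omega> = b \<and> C \<omega> = c}) * ennreal (measure p {\<omega>. B \<omega> = b})
      = (\<integral>\<^sup>+a. ennreal (measure p {\<omega>. (Q (A \<omega>) \<and> B \<omega> = b \<and> C \<omega> = c) \<and> A \<omega> = a})
          * ennreal (measure p {\<omega>. B \<omega> = b}) \<partial>count_space UNIV)"
    by (simp only: nn_integral_prob_slices nn_integral_multc borel_measurable_count_space)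
  also have "\<dots> = (\<integral>\<^sup>+a. ennreal (measure p {\<omega>. (Q (A \<omega>) \<and> B \<omega> = b) \<and> A \<omega> = a})
          * ennreal (measure p {\<omega>. B \<omega> = b \<and> C \<omega> = c}) \<partial>count_space UNIV)"
    by (simp only: ennreal_mult[symmetric] measure_nonneg slice)
  also have "\<dots> = ennreal (measure p {\<omega>. Q (A \<omega>) \<and> B \<omega> = b}) * ennreal (measure p {\<omega>. B \<omega> = b \<and> C \<omega> = c})"
    by (simp only: nn_integral_prob_slices nn_integral_multc borel_measurable_count_space)
  finally show ?thesis
    by (simp add: ennreal_mult[symmetric])
qed

lemma markov_chain_map_pmf:
  "markov_chain (map_pmf f p) A B C \<longleftrightarrow> markov_chain p (\<lambda>\<omega>. A (f \<omega>)) (\<lambda>\<omega>. B (f \<omega>)) (\<lambda>\<omega>. C (f \<omega>))"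
  by (simp add: markov_chain_def cond_prob_def vimage_def)

lemma markov_chain_given_unit:
  fixes Z :: "'w \<Rightarrow> unit"
  shows "markov_chain_given p A B C Z \<longleftrightarrow> markov_chain p A B C"
  by (simp add: markov_chain_given_def markov_chain_def cond_prob_def)

text \<open>Makes a deterministic estimator computed from \<open>Y\<close> admissible as the last
  variable of the four-term chain.\<close>

lemma markov_chain_function: "markov_chain p A B (\<lambda>\<omega>. h (B \<omega>))"
proof (rule markov_chainI)
  fix a b c
  show "measure p {\<omega>. A \<omega> = a \<and> B \<omega> = b \<and> h (B \<omega>) = c} * measure p {\<omega>. B \<omega> = b}
      = measure p {\<omega>. A \<omega> = a \<and> B \<omega> = b} * measure p {\<omega>. B \<omega> = b \<and> h (B \<omega>) = c}"
  proof (cases "h b = c")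
    case True
    then have "{\<omega>. A \<omega> = a \<and> B \<omega> = b \<and> h (B \<omega>) = c} = {\<omega>. A \<omega> = a \<and> B \<omega> = b}"
      "{\<omega>. B \<omega> = b \<and> h (B \<omega>) = c} = {\<omega>. B \<omega> = b}" by auto
    then show ?thesis by simp
  next
    case False
    then have "{\<omega>. A \<omega> = a \<and> B \<omega> = b \<and> h (B \<omega>) = c} = {}"
      "{\<omega>. B \<omega> = b \<and> h (B \<omega>) = c} = {}" by auto
    then show ?thesis by (simp only: measure_empty mult_zero_left mult_zero_right)
  qed
qed

lemma max_leakage_eq_SUP:
  "max_leakage p X Y =
     (SUP (\<U>, q :: (nat \<times> _) pmf) \<in> {(\<U> :: nat set, q). finite \<U> \<and> fst ` set_pmf q \<subseteq> \<U> \<and>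
        (\<lambda>\<omega>. snd (snd (snd \<omega>))) ` set_pmf q \<subseteq> \<U> \<and>
        map_pmf (\<lambda>\<omega>. (fst (snd \<omega>), fst (snd (snd \<omega>)))) q = map_pmf (\<lambda>\<omega>. (X \<omega>, Y \<omega>)) p \<and>
        markov_chain4 q fst (\<lambda>\<omega>. fst (snd \<omega>)) (\<lambda>\<omega>. fst (snd (snd \<omega>))) (\<lambda>\<omega>. snd (snd (snd \<omega>)))}.
      elog (measure (measure_pmf q) {\<omega>. fst \<omega> = snd (snd (snd \<omega>))} / (MAX u\<in>\<U>. pmf (map_pmf fst q) u)))"
proof -
  have proj: "(\<lambda>(u, x, y, z). u) = fst" "(\<lambda>(u, x, y, z). x) = (\<lambda>\<omega>. fst (snd \<omega>))"
    "(\<lambda>(u, x, y, z). y) = (\<lambda>\<omega>. fst (snd (snd \<omega>)))" "(\<lambda>(u, x, y, z). z) = (\<lambda>\<omega>. snd (snd (snd \<omega>)))"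
    by (auto simp: fun_eq_iff)
  show ?thesis
    unfolding max_leakage_def Let_def proj set_map_pmf by simp
qed

lemma Max_pmf_pos:
  assumes "finite \<U>" "U ` set_pmf p \<subseteq> \<U>"
  shows "0 < (MAX u\<in>\<U>. pmf (map_pmf U p) u)"
proof -
  obtain \<omega> where "\<omega> \<in> set_pmf p"
    using set_pmf_not_empty[of p] by blast
  then have "0 < pmf (map_pmf U p) (U \<omega>)"
    by (intro pmf_positive) simp
  also have "\<dots> \<le> (MAX u\<in>\<U>. pmf (map_pmf U p) u)"
    using assms \<open>\<omega> \<in> set_pmf p\<close> by (intro Max_ge) auto
  finally show ?thesis .
qed

text \<open>Given \<open>Y = y\<close>, the estimate \<open>V\<close> is independent of
  \<open>U\<close>. So the success probability on this slice is an average of the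
  \<open>P(u, y)\<close>, weighted by the law of \<open>V\<close> given \<open>y\<close>, and each
  \<open>P(u, y)\<close> obeys the bound used for deterministic guesses.\<close>

lemma randomized_guess_le_sum_max:
  assumes M: "markov_chain4 p U X Y V" and \<U>: "finite \<U>" "U ` set_pmf p \<subseteq> \<U>"
  shows "ennreal (measure p {\<omega>. U \<omega> = V \<omega>})
    \<le> ennreal (MAX u\<in>\<U>. pmf (map_pmf U p) u) * sum_max p X Y (\<lambda>_. ())"
proof -
  let ?m = "MAX u\<in>\<U>. pmf (map_pmf U p) u"
  have M1: "markov_chain_given p U X Y (\<lambda>_. ())"
    using M by (simp add: markov_chain_given_unit markov_chain4_def)
  have M2: "markov_chain p (\<lambda>\<omega>. (U \<omega>, X \<omega>)) Y V"
    using M by (simp add: markov_chain4_def)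
  define G where "G y = (SUP x. ennreal (channel p X Y (\<lambda>_. ()) x y ()))" for y
  have le_m: "measure p {\<omega>. U \<omega> = u} \<le> ?m" for u
  proof (cases "u \<in> \<U>")
    case True
    have "measure p {\<omega>. U \<omega> = u} = pmf (map_pmf U p) u"
      by (simp add: pmf_map vimage_def)
    then show ?thesis
      using True \<U>(1) by (simp add: Max_ge)
  next
    case False
    then have "measure p {\<omega>. U \<omega> = u} = 0"
      using \<U> by (auto simp: measure_pmf_zero_iff)
    then show ?thesis
      using Max_pmf_pos[OF \<U>] by simp
  qed
  have uy_le: "ennreal (measure p {\<omega>. U \<omega> = u \<and> Y \<omega> = y}) \<le> ennreal ?m * G y" for u y
    using markov_chain_given_joint_le[OF M1, of u "()" y] mult_right_mono[OF ennreal_leI[OF le_m[of u]], of "G y"]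
    by (simp add: G_def)
  have y_slice: "ennreal (measure p {\<omega>. U \<omega> = V \<omega> \<and> Y \<omega> = y}) \<le> ennreal ?m * G y" for y
  proof (cases "measure p {\<omega>. Y \<omega> = y} = 0")
    case True
    have "measure p {\<omega>. U \<omega> = V \<omega> \<and> Y \<omega> = y} \<le> measure p {\<omega>. Y \<omega> = y}"
      by (rule measure_pmf.finite_measure_mono) auto
    then show ?thesis
      using True by (simp add: measure_le_0_iff)
  next
    case False
    let ?c = "measure p {\<omega>. Y \<omega> = y}"
    have "ennreal (measure p {\<omega>. U \<omega> = V \<omega> \<and> Y \<omega> = y}) * ennreal ?c
        = (\<integral>\<^sup>+u. ennreal (measure p {\<omega>. (U \<omega> = V \<omega> \<and> Y \<omega> = y) \<and> V \<omega> = u}) * ennreal ?c \<partial>count_space UNIV)"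
      by (simp only: nn_integral_prob_slices nn_integral_multc borel_measurable_count_space)
    also have "\<dots> \<le> (\<integral>\<^sup>+u. ennreal ?m * G y * ennreal (measure p {\<omega>. Y \<omega> = y \<and> V \<omega> = u}) \<partial>count_space UNIV)"
    proof (rule nn_integral_mono)
      fix u
      have "{\<omega>. (U \<omega> = V \<omega> \<and> Y \<omega> = y) \<and> V \<omega> = u} = {\<omega>. fst (U \<omega>, X \<omega>) = u \<and> Y \<omega> = y \<and> V \<omega> = u}"
        by auto
      then have "ennreal (measure p {\<omega>. (U \<omega> = V \<omega> \<and> Y \<omega> = y) \<and> V \<omega> = u}) * ennreal ?c
          = ennreal (measure p {\<omega>. U \<omega> = u \<and> Y \<omega> = y}) * ennreal (measure p {\<omega>. Y \<omega> = y \<and> V \<omega> = u})"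
        using markov_chain_event[OF M2, of "\<lambda>a. fst a = u" y u] by (simp add: ennreal_mult[symmetric])
      also have "\<dots> \<le> ennreal ?m * G y * ennreal (measure p {\<omega>. Y \<omega> = y \<and> V \<omega> = u})"
        by (intro mult_right_mono uy_le) simp
      finally show "ennreal (measure p {\<omega>. (U \<omega> = V \<omega> \<and> Y \<omega> = y) \<and> V \<omega> = u}) * ennreal ?c
          \<le> ennreal ?m * G y * ennreal (measure p {\<omega>. Y \<omega> = y \<and> V \<omega> = u})" .
    qed
    also have "\<dots> = ennreal ?m * G y * ennreal ?c"
      by (simp only: nn_integral_prob_slices nn_integral_cmult borel_measurable_count_space)
    finally show ?thesis
      using False by (subst (asm) (1 2) mult.commute[of _ "ennreal ?c"], subst (asm) ennreal_mult_le_mult_iff) simp_all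
  qed
  have "ennreal (measure p {\<omega>. U \<omega> = V \<omega>})
      = (\<integral>\<^sup>+y. ennreal (measure p {\<omega>. U \<omega> = V \<omega> \<and> Y \<omega> = y}) \<partial>count_space UNIV)"
    by (rule nn_integral_prob_slices[symmetric])
  also have "\<dots> \<le> (\<integral>\<^sup>+y. ennreal ?m * G y \<partial>count_space UNIV)"
    by (intro nn_integral_mono y_slice)
  also have "\<dots> = ennreal ?m * sum_max_at p X Y (\<lambda>_. ()) ()"
    unfolding sum_max_at_def G_def by (rule nn_integral_cmult) simp
  also have "\<dots> \<le> ennreal ?m * sum_max p X Y (\<lambda>_. ())"
    by (intro mult_left_mono sum_max_at_le) simp
  finally show ?thesis .
qed

lemma max_leakage_le_sum_max:
  assumes "finite (X ` set_pmf p)"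
  shows "max_leakage p X Y \<le> ereal (ln (enn2real (sum_max p X Y (\<lambda>_. ()))))"
  unfolding max_leakage_eq_SUP
proof (rule SUP_least, clarify)
  fix \<U> :: "nat set" and q :: "(nat \<times> _ \<times> _ \<times> nat) pmf"
  let ?X = "\<lambda>\<omega>. fst (snd \<omega>)" and ?Y = "\<lambda>\<omega>. fst (snd (snd \<omega>))" and ?V = "\<lambda>\<omega>. snd (snd (snd \<omega>))"
  assume \<U>: "finite \<U>" "fst ` set_pmf q \<subseteq> \<U>"
    and q: "map_pmf (\<lambda>\<omega>. (?X \<omega>, ?Y \<omega>)) q = map_pmf (\<lambda>\<omega>. (X \<omega>, Y \<omega>)) p"
    and M: "markov_chain4 q fst ?X ?Y ?V"
  define num where "num = measure q {\<omega>. fst \<omega> = ?V \<omega>}"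
  define den where "den = (MAX u\<in>\<U>. pmf (map_pmf fst q) u)"
  let ?k = "enn2real (sum_max p X Y (\<lambda>_. ()))"
  have "map_pmf (\<lambda>\<omega>. (?X \<omega>, ?Y \<omega>, ())) q = map_pmf (\<lambda>\<omega>. (X \<omega>, Y \<omega>, ())) p"
    using arg_cong[OF q, of "map_pmf (\<lambda>(x, y). (x, y, ()))"] by (simp add: pmf.map_comp o_def)
  then have k: "sum_max q ?X ?Y (\<lambda>_. ()) = ennreal ?k" "1 \<le> ?k"
    using enn2real_sum_max[OF assms, of Y "\<lambda>_. ()"] by (auto intro!: sum_max_cong_joint)
  have den: "0 < den"
    unfolding den_def by (rule Max_pmf_pos[OF \<U>])
  have "ennreal num \<le> ennreal den * ennreal ?k"
    unfolding num_def den_def k(1)[symmetric] by (rule randomized_guess_le_sum_max[OF M \<U>])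
  then have "num / den \<le> ?k"
    using den k(2) by (simp add: ennreal_mult[symmetric] divide_le_eq mult.commute)
  moreover have "0 \<le> num / den"
    using den by (simp add: num_def)
  ultimately have "elog (num / den) \<le> elog ?k"
    by (rule elog_mono[rotated])
  then show "elog (num / den) \<le> ereal (ln ?k)"
    using k(2) by (simp add: elog_pos)
qed

text \<open>Extend each admissible \<open>U\<close> by its own MAP estimate from \<open>Y\<close> as
  the fourth variable. The numerator is unchanged, and the new denominator, the mass of the
  likeliest symbol, is no larger than the blind MAP success.\<close>

lemma cond_max_leakage_le_max_leakage:
  fixes p :: "'w pmf" and X :: "'w \<Rightarrow> 'x" and Y :: "'w \<Rightarrow> 'y"
  shows "cond_max_leakage p X Y (\<lambda>_. ()) \<le> max_leakage p X Y"
  unfolding cond_max_leakage_eq_SUP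
proof (rule SUP_least, clarify)
  fix \<U> :: "nat set" and q :: "(nat \<times> 'x \<times> 'y \<times> unit) pmf"
  let ?X = "\<lambda>\<omega>. fst (snd \<omega>)" and ?Y = "\<lambda>\<omega>. fst (snd (snd \<omega>))" and ?V = "\<lambda>\<omega>. snd (snd (snd \<omega>))"
  assume \<U>: "finite \<U>" "fst ` set_pmf q \<subseteq> \<U>"
    and q: "map_pmf snd q = map_pmf (\<lambda>\<omega>. (X \<omega>, Y \<omega>, ())) p"
    and M: "markov_chain_given q fst ?X ?Y (\<lambda>_. ())"
  have "\<U> \<noteq> {}"
    using \<U>(2) set_pmf_not_empty[of q] by auto
  define h where "h y = map_estimator q \<U> fst (\<lambda>\<omega>. (?Y \<omega>, ())) (y, ())" for y
  define r where "r = map_pmf (\<lambda>\<omega>. (fst \<omega>, ?X \<omega>, ?Y \<omega>, h (?Y \<omega>))) q"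
  have h_in: "h y \<in> \<U>" for y
    unfolding h_def by (rule map_estimator_in[OF \<U>(1) \<open>\<U> \<noteq> {}\<close>])
  have marg: "map_pmf (\<lambda>\<omega>. (?X \<omega>, ?Y \<omega>)) r = map_pmf (\<lambda>\<omega>. (X \<omega>, Y \<omega>)) p"
    using arg_cong[OF q, of "map_pmf (\<lambda>(x, y, _). (x, y))"] by (simp add: r_def pmf.map_comp o_def case_prod_beta)
  have "markov_chain4 r fst ?X ?Y ?V"
    using M markov_chain_function[of q "\<lambda>\<omega>. (fst \<omega>, ?X \<omega>)" ?Y h]
    by (simp add: markov_chain4_def r_def markov_chain_map_pmf markov_chain_given_unit)
  then have mem: "(\<U>, r) \<in> {(\<U> :: nat set, q). finite \<U> \<and> fst ` set_pmf q \<subseteq> \<U> \<and> ?V ` set_pmf q \<subseteq> \<U> \<and>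
        map_pmf (\<lambda>\<omega>. (?X \<omega>, ?Y \<omega>)) q = map_pmf (\<lambda>\<omega>. (X \<omega>, Y \<omega>)) p \<and> markov_chain4 q fst ?X ?Y ?V}"
    using \<U> h_in marg by (auto simp: r_def)
  have num: "measure r {\<omega>. fst \<omega> = ?V \<omega>}
      = measure q {\<omega>. fst \<omega> = map_estimator q \<U> fst (\<lambda>\<omega>. (?Y \<omega>, ())) (?Y \<omega>, ())}"
    by (simp add: r_def h_def vimage_def)
  have fst_r: "map_pmf fst r = map_pmf fst q"
    by (simp add: r_def pmf.map_comp o_def)
  have "pmf (map_pmf fst q) u \<le> measure q {\<omega>. fst \<omega> = map_estimator q \<U> fst (\<lambda>_. ()) ()}" if "u \<in> \<U>" for u
    using map_estimator_max[OF \<U>(1) \<open>\<U> \<noteq> {}\<close> that, of q fst "\<lambda>_. ()" "()"] by (simp add: pmf_map vimage_def)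
  then have den: "(MAX u\<in>\<U>. pmf (map_pmf fst r) u) \<le> measure q {\<omega>. fst \<omega> = map_estimator q \<U> fst (\<lambda>_. ()) ()}"
    using \<U>(1) \<open>\<U> \<noteq> {}\<close> by (simp add: fst_r)
  have "0 < (MAX u\<in>\<U>. pmf (map_pmf fst r) u)"
    unfolding fst_r by (rule Max_pmf_pos[OF \<U>])
  then have "elog (measure q {\<omega>. fst \<omega> = map_estimator q \<U> fst (\<lambda>\<omega>. (?Y \<omega>, ())) (?Y \<omega>, ())} /
        measure q {\<omega>. fst \<omega> = map_estimator q \<U> fst (\<lambda>_. ()) ()})
      \<le> elog (measure r {\<omega>. fst \<omega> = ?V \<omega>} / (MAX u\<in>\<U>. pmf (map_pmf fst r) u))"
    unfolding num using den by (intro elog_mono divide_left_mono mult_pos_pos) auto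
  also have "\<dots> \<le> max_leakage p X Y"
    unfolding max_leakage_eq_SUP by (rule SUP_upper2[OF mem]) simp
  finally show "elog (measure q {\<omega>. fst \<omega> = map_estimator q \<U> fst (\<lambda>\<omega>. (?Y \<omega>, ())) (?Y \<omega>, ())} /
        measure q {\<omega>. fst \<omega> = map_estimator q \<U> fst (\<lambda>_. ()) ()}) \<le> max_leakage p X Y" .
qed

text \<open>Squeeze: the closed form bounds randomised estimators from above, and by the preceding
  lemma the conditional leakage with constant \<open>Z\<close> bounds the maximal leakage from
  below.\<close>

lemma max_leakage_eq:
  assumes "finite (X ` set_pmf p)"
  shows "max_leakage p X Y = ereal (ln (enn2real (sum_max p X Y (\<lambda>_. ()))))"
  using max_leakage_le_sum_max[OF assms] cond_max_leakage_le_max_leakage[of p X Y]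
  unfolding cond_max_leakage_eq[OF assms] by (rule antisym)

section \<open>Data processing, independence and chain rule\<close>

text \<open>Moves comparisons of leakages to \<open>ennreal\<close>, where sums of maxima are
  compared without logarithms.\<close>

lemma cond_max_leakage_le_iff:
  assumes "finite (X ` set_pmf p)" "0 < c"
  shows "cond_max_leakage p X Y Z \<le> ereal (ln c) \<longleftrightarrow> sum_max p X Y Z \<le> ennreal c"
proof -
  let ?k = "enn2real (sum_max p X Y Z)"
  have k: "sum_max p X Y Z = ennreal ?k" "1 \<le> ?k"
    using enn2real_sum_max[OF assms(1), of Y Z] by simp_all
  have "sum_max p X Y Z \<le> ennreal c \<longleftrightarrow> ?k \<le> c"
    using assms(2) by (subst k(1)) simp
  then show ?thesis
    using k(2) assms by (simp add: cond_max_leakage_eq)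
qed

lemma cond_max_leakage_mono:
  assumes "finite (X ` set_pmf p)" "finite (X' ` set_pmf p')" "sum_max p X Y Z \<le> sum_max p' X' Y' Z'"
  shows "cond_max_leakage p X Y Z \<le> cond_max_leakage p' X' Y' Z'"
  using assms(3) enn2real_sum_max[OF assms(2), of Y' Z']
  by (simp add: cond_max_leakage_eq[OF assms(2)] cond_max_leakage_le_iff[OF assms(1)])

text \<open>A counting measure on an uncountable type is not sigma-finite, so both iterated sums are
  identified with the sum over the product type.\<close>

lemma nn_integral_count_space_swap:
  "(\<integral>\<^sup>+x. \<integral>\<^sup>+y. f x y \<partial>count_space UNIV \<partial>count_space UNIV)
     = (\<integral>\<^sup>+y. \<integral>\<^sup>+x. f x y \<partial>count_space UNIV \<partial>count_space UNIV)"
  using nn_integral_fst_count_space[of "\<lambda>(x, y). f x y"] nn_integral_snd_count_space[of "\<lambda>(x, y). f x y"]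
  by simp

lemma sum_max_unit: "sum_max p X Y (\<lambda>_. ()) = sum_max_at p X Y (\<lambda>_. ()) ()"
  by (simp add: sum_max_def UNIV_unit)

lemma sum_max_at_leI: "(\<And>x y. ennreal (channel p X Y Z x y z) \<le> G y)
    \<Longrightarrow> sum_max_at p X Y Z z \<le> (\<integral>\<^sup>+y. G y \<partial>count_space UNIV)"
  unfolding sum_max_at_def by (intro nn_integral_mono SUP_least)

text \<open>The Chapman-Kolmogorov equation for each fixed \<open>z\<close>. Multiplied by
  \<open>P(x, z)\<close> it is total probability over \<open>y\<close>; at an impossible input both
  sides are 0 by the default of division.\<close>

lemma channel_compose:
  assumes "markov_chain_given p X Y V Z"
  shows "ennreal (channel p X V Z x v z)
    = (\<integral>\<^sup>+y. ennreal (channel p X Y Z x y z) * ennreal (channel p Y V Z y v z) \<partial>count_space UNIV)"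
proof (cases "measure p {\<omega>. X \<omega> = x \<and> Z \<omega> = z} = 0")
  case True
  then show ?thesis
    by (simp add: channel_def)
next
  case False
  let ?c = "measure p {\<omega>. X \<omega> = x \<and> Z \<omega> = z}"
  have factor: "channel p X Y Z x y z * channel p Y V Z y v z * ?c
      = measure p {\<omega>. (X \<omega> = x \<and> Z \<omega> = z \<and> V \<omega> = v) \<and> Y \<omega> = y}" for y
  proof (cases "measure p {\<omega>. Y \<omega> = y \<and> Z \<omega> = z} = 0")
    case True
    have "measure p {\<omega>. (X \<omega> = x \<and> Z \<omega> = z \<and> V \<omega> = v) \<and> Y \<omega> = y} \<le> measure p {\<omega>. Y \<omega> = y \<and> Z \<omega> = z}"
      by (rule measure_pmf.finite_measure_mono) auto
    then show ?thesis
      using True by (simp add: channel_def[of _ Y] measure_le_0_iff)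
  next
    case pos: False
    have "channel p X Y Z x y z * channel p Y V Z y v z * ?c * measure p {\<omega>. Y \<omega> = y \<and> Z \<omega> = z}
        = (channel p X Y Z x y z * ?c) * (channel p Y V Z y v z * measure p {\<omega>. Y \<omega> = y \<and> Z \<omega> = z})"
      by (simp add: mult_ac)
    also have "\<dots> = measure p {\<omega>. X \<omega> = x \<and> (Y \<omega>, Z \<omega>) = (y, z)} * measure p {\<omega>. (Y \<omega>, Z \<omega>) = (y, z) \<and> V \<omega> = v}"
      unfolding channel_mult by (intro arg_cong2[where f = "(*)"] arg_cong2[where f = measure]) auto
    also have "\<dots> = measure p {\<omega>. X \<omega> = x \<and> (Y \<omega>, Z \<omega>) = (y, z) \<and> V \<omega> = v} * measure p {\<omega>. (Y \<omega>, Z \<omega>) = (y, z)}"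
      using assms unfolding markov_chain_given_def by (rule markov_chain_measure[symmetric])
    also have "\<dots> = measure p {\<omega>. (X \<omega> = x \<and> Z \<omega> = z \<and> V \<omega> = v) \<and> Y \<omega> = y} * measure p {\<omega>. Y \<omega> = y \<and> Z \<omega> = z}"
      by (intro arg_cong2[where f = "(*)"] arg_cong2[where f = measure]) auto
    finally show ?thesis
      using pos by simp
  qed
  have "ennreal (channel p X V Z x v z) * ennreal ?c = ennreal (measure p {\<omega>. X \<omega> = x \<and> Z \<omega> = z \<and> V \<omega> = v})"
    by (simp add: ennreal_mult[symmetric] channel_mult)
  also have "\<dots> = (\<integral>\<^sup>+y. ennreal (measure p {\<omega>. (X \<omega> = x \<and> Z \<omega> = z \<and> V \<omega> = v) \<and> Y \<omega> = y}) \<partial>count_space UNIV)"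
    by (rule nn_integral_prob_slices[symmetric])
  also have "\<dots> = (\<integral>\<^sup>+y. ennreal (channel p X Y Z x y z) * ennreal (channel p Y V Z y v z) * ennreal ?c \<partial>count_space UNIV)"
    unfolding factor[symmetric] by (simp add: ennreal_mult)
  also have "\<dots> = (\<integral>\<^sup>+y. ennreal (channel p X Y Z x y z) * ennreal (channel p Y V Z y v z) \<partial>count_space UNIV) * ennreal ?c"
    by (rule nn_integral_multc) simp
  finally show ?thesis
    using False by (subst (asm) (1 2) mult.commute[of _ "ennreal ?c"]) (simp add: ennreal_mult_cancel_left)
qed

text \<open>Push the maximum over \<open>x\<close> inside the sum over \<open>y\<close>, then sum
  over \<open>v\<close> first: the second channel contributes at most 1 for each
  \<open>y\<close>.\<close>

lemma sum_max_data_processing_left: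
  assumes "markov_chain_given p X Y V Z"
  shows "sum_max p X V Z \<le> sum_max p X Y Z"
  unfolding sum_max_def
proof (rule SUP_mono)
  fix z
  let ?G = "\<lambda>y. SUP x. ennreal (channel p X Y Z x y z)"
  have "sum_max_at p X V Z z \<le> (\<integral>\<^sup>+v. \<integral>\<^sup>+y. ?G y * ennreal (channel p Y V Z y v z) \<partial>count_space UNIV \<partial>count_space UNIV)"
    unfolding channel_compose[OF assms] sum_max_at_def
    by (intro nn_integral_mono SUP_least mult_right_mono SUP_upper) auto
  also have "\<dots> = (\<integral>\<^sup>+y. \<integral>\<^sup>+v. ?G y * ennreal (channel p Y V Z y v z) \<partial>count_space UNIV \<partial>count_space UNIV)"
    by (rule nn_integral_count_space_swap)
  also have "\<dots> = (\<integral>\<^sup>+y. ?G y * (\<integral>\<^sup>+v. ennreal (channel p Y V Z y v z) \<partial>count_space UNIV) \<partial>count_space UNIV)"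
    by (simp add: nn_integral_cmult)
  also have "\<dots> \<le> (\<integral>\<^sup>+y. ?G y * 1 \<partial>count_space UNIV)"
    unfolding channel_sum by (intro nn_integral_mono mult_left_mono) auto
  finally show "\<exists>z'\<in>UNIV. sum_max_at p X V Z z \<le> sum_max_at p X Y Z z'"
    by (auto simp: sum_max_at_def)
qed

text \<open>For every \<open>x\<close> the composed channel averages \<open>P(v|y, z)\<close> over
  \<open>y\<close>, and an average is at most the maximum.\<close>

lemma sum_max_data_processing_right:
  assumes "markov_chain_given p X Y V Z"
  shows "sum_max p X V Z \<le> sum_max p Y V Z"
  unfolding sum_max_def
proof (rule SUP_mono)
  fix z
  have "ennreal (channel p X V Z x v z) \<le> (SUP y. ennreal (channel p Y V Z y v z))" for x v
  proof -
    let ?G = "SUP y. ennreal (channel p Y V Z y v z)"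
    have "ennreal (channel p X V Z x v z) \<le> (\<integral>\<^sup>+y. ennreal (channel p X Y Z x y z) * ?G \<partial>count_space UNIV)"
      unfolding channel_compose[OF assms] by (intro nn_integral_mono mult_left_mono SUP_upper) auto
    also have "\<dots> = (\<integral>\<^sup>+y. ennreal (channel p X Y Z x y z) \<partial>count_space UNIV) * ?G"
      by (rule nn_integral_multc) simp
    also have "\<dots> \<le> 1 * ?G"
      unfolding channel_sum by (intro mult_right_mono) auto
    finally show ?thesis by simp
  qed
  then show "\<exists>z'\<in>UNIV. sum_max_at p X V Z z \<le> sum_max_at p Y V Z z'"
    unfolding sum_max_at_def[of p Y] by (intro bexI[of _ z] sum_max_at_leI) auto
qed

section \<open>Zero leakage and conditional independence\<close>

lemma channel_markov:
  assumes "markov_chain p X Z Y" "measure p {\<omega>. X \<omega> = x \<and> Z \<omega> = z} \<noteq> 0"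
  shows "channel p X Y Z x y z = measure p {\<omega>. Z \<omega> = z \<and> Y \<omega> = y} / measure p {\<omega>. Z \<omega> = z}"
proof -
  have "measure p {\<omega>. X \<omega> = x \<and> Z \<omega> = z} \<le> measure p {\<omega>. Z \<omega> = z}"
    by (rule measure_pmf.finite_measure_mono) auto
  then have "measure p {\<omega>. Z \<omega> = z} \<noteq> 0"
    using assms(2) by (auto simp: measure_le_0_iff)
  then show ?thesis
    using markov_chain_measure[OF assms(1), of x z y] assms(2) by (simp add: channel_def field_simps)
qed

lemma sum_max_le_1_if_markov:
  assumes "markov_chain p X Z Y"
  shows "sum_max p X Y Z \<le> 1"
  unfolding sum_max_def
proof (rule SUP_least)
  fix z
  let ?c = "measure p {\<omega>. Z \<omega> = z}"
  have "sum_max_at p X Y Z z \<le> (\<integral>\<^sup>+y. ennreal (measure p {\<omega>. Z \<omega> = z \<and> Y \<omega> = y} / ?c) \<partial>count_space UNIV)"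
  proof (rule sum_max_at_leI)
    fix x y
    show "ennreal (channel p X Y Z x y z) \<le> ennreal (measure p {\<omega>. Z \<omega> = z \<and> Y \<omega> = y} / ?c)"
    proof (cases "measure p {\<omega>. X \<omega> = x \<and> Z \<omega> = z} = 0")
      case True
      then show ?thesis by (simp add: channel_def)
    qed (simp add: channel_markov[OF assms])
  qed
  also have "\<dots> \<le> 1"
  proof (cases "?c = 0")
    case False
    then have pos: "?c > 0"
      by (simp add: less_le)
    then have "(\<integral>\<^sup>+y. ennreal (measure p {\<omega>. Z \<omega> = z \<and> Y \<omega> = y} / ?c) \<partial>count_space UNIV)
        = (\<integral>\<^sup>+y. ennreal (measure p {\<omega>. Z \<omega> = z \<and> Y \<omega> = y}) / ennreal ?c \<partial>count_space UNIV)"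
      by (simp add: divide_ennreal)
    also have "\<dots> = ennreal ?c / ennreal ?c"
      by (simp only: nn_integral_divide nn_integral_prob_slices borel_measurable_count_space)
    finally show ?thesis
      using pos by (simp add: divide_ennreal)
  qed simp
  finally show "sum_max_at p X Y Z z \<le> 1" .
qed

text \<open>Each possible row sums to 1 and lies below the pointwise maxima, whose sum is also at
  most 1. So every such row equals the maxima, and \<open>P(y|x, z)\<close> does not depend on
  \<open>x\<close>.\<close>

lemma markov_if_sum_max_le_1:
  assumes "sum_max p X Y Z \<le> 1"
  shows "markov_chain p X Z Y"
proof (rule markov_chainI)
  fix x z y
  assume "z \<in> Z ` set_pmf p"
  then obtain s where s: "s \<in> set_pmf p" "Z s = z" by blast
  let ?P = "\<lambda>x. measure p {\<omega>. X \<omega> = x \<and> Z \<omega> = z}"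
  let ?G = "\<lambda>y. SUP x. ennreal (channel p X Y Z x y z)"
  have eq_G: "?G y = ennreal (channel p X Y Z x y z)" if x: "?P x \<noteq> 0" for x y
  proof -
    let ?f = "\<lambda>y. ennreal (channel p X Y Z x y z)"
    have f1: "(\<integral>\<^sup>+y. ?f y \<partial>count_space UNIV) = 1"
      using x by (simp add: channel_sum)
    have le: "?f y \<le> ?G y" for y
      by (rule SUP_upper) simp
    \<comment> \<open>The gap is nonnegative with integral 0, and the counting measure has no
      nonempty null sets, so it vanishes at every \<open>y\<close>.\<close>
    have "(\<integral>\<^sup>+y. ?G y - ?f y \<partial>count_space UNIV) = (\<integral>\<^sup>+y. ?G y \<partial>count_space UNIV) - (\<integral>\<^sup>+y. ?f y \<partial>count_space UNIV)"
      using le f1 by (intro nn_integral_diff) auto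
    also have "\<dots> = 0"
      using order.trans[OF sum_max_at_le[of p X Y Z z] assms] unfolding f1 sum_max_at_def
      by (simp add: diff_eq_0_iff_ennreal le_less_trans[OF _ ennreal_one_less_top])
    finally have "?G y - ?f y = 0"
      by (simp add: nn_integral_0_iff_AE AE_count_space)
    then show ?thesis
      using le[of y] by (intro antisym) (simp_all add: diff_eq_0_iff_ennreal)
  qed
  have "?P (X s) > 0"
    using s by (intro measure_pmf_posI) auto
  define g where "g = channel p X Y Z (X s) y z"
  have xzy: "measure p {\<omega>. X \<omega> = x \<and> Z \<omega> = z \<and> Y \<omega> = y} = g * ?P x" for x
  proof (cases "?P x = 0")
    case True
    then show ?thesis
      using channel_mult[of p X Y Z x y z] by simp
  next
    case False
    have "ennreal (channel p X Y Z x y z) = ennreal g"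
      using eq_G[OF False, of y] eq_G[of "X s" y] \<open>?P (X s) > 0\<close> by (simp add: g_def)
    then show ?thesis
      using channel_mult[of p X Y Z x y z] by (simp add: g_def)
  qed
  have "ennreal (measure p {\<omega>. Z \<omega> = z \<and> Y \<omega> = y})
      = (\<integral>\<^sup>+x. ennreal (measure p {\<omega>. (Z \<omega> = z \<and> Y \<omega> = y) \<and> X \<omega> = x}) \<partial>count_space UNIV)"
    by (rule nn_integral_prob_slices[symmetric])
  also have "\<dots> = (\<integral>\<^sup>+x. ennreal g * ennreal (measure p {\<omega>. Z \<omega> = z \<and> X \<omega> = x}) \<partial>count_space UNIV)"
    using xzy by (simp add: ennreal_mult[symmetric] g_def conj_ac)
  also have "\<dots> = ennreal g * ennreal (measure p {\<omega>. Z \<omega> = z})"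
    by (simp only: nn_integral_cmult nn_integral_prob_slices borel_measurable_count_space)
  finally have "measure p {\<omega>. Z \<omega> = z \<and> Y \<omega> = y} = g * measure p {\<omega>. Z \<omega> = z}"
    by (simp add: ennreal_mult[symmetric] g_def)
  then show "measure p {\<omega>. X \<omega> = x \<and> Z \<omega> = z \<and> Y \<omega> = y} * measure p {\<omega>. Z \<omega> = z}
      = ?P x * measure p {\<omega>. Z \<omega> = z \<and> Y \<omega> = y}"
    by (simp add: xzy)
qed

section \<open>Comparison with the unconditional leakage when \<open>Z\<close> acts through the
  input\<close>

lemma channel_markov_input:
  assumes "markov_chain p Z X Y" "measure p {\<omega>. X \<omega> = x \<and> Z \<omega> = z} \<noteq> 0"
  shows "channel p X Y Z x y z = channel p X Y (\<lambda>_. ()) x y ()"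
proof -
  have "measure p {\<omega>. X \<omega> = x \<and> Z \<omega> = z} \<le> measure p {\<omega>. X \<omega> = x}"
    by (rule measure_pmf.finite_measure_mono) auto
  then have "measure p {\<omega>. X \<omega> = x} \<noteq> 0"
    using assms(2) by (auto simp: measure_le_0_iff)
  then show ?thesis
    using markov_chain_measure[OF assms(1), of z x y] assms(2)
    by (simp add: channel_def field_simps conj_ac)
qed

text \<open>The channel no longer depends on \<open>z\<close>; conditioning only shrinks the set of
  inputs over which the maximum is taken.\<close>

lemma sum_max_le_unconditional:
  assumes "markov_chain p Z X Y"
  shows "sum_max p X Y Z \<le> sum_max p X Y (\<lambda>_. ())"
  unfolding sum_max_unit unfolding sum_max_def
proof (rule SUP_least)
  fix z
  have "ennreal (channel p X Y Z x y z) \<le> (SUP x. ennreal (channel p X Y (\<lambda>_. ()) x y ()))" for x y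
  proof (cases "measure p {\<omega>. X \<omega> = x \<and> Z \<omega> = z} = 0")
    case True
    then show ?thesis by (simp add: channel_def)
  next
    case False
    then show ?thesis
      unfolding channel_markov_input[OF assms False] by (intro SUP_upper) simp
  qed
  then show "sum_max_at p X Y Z z \<le> sum_max_at p X Y (\<lambda>_. ()) ()"
    unfolding sum_max_at_def[of p X Y "\<lambda>_. ()"] by (rule sum_max_at_leI)
qed

text \<open>At a \<open>z\<close> that leaves every input of positive probability possible, the
  maximum runs over the same rows as without conditioning.\<close>

lemma unconditional_le_sum_max:
  assumes M: "markov_chain p Z X Y"
    and full: "\<And>x. x \<in> X ` set_pmf p \<Longrightarrow> \<exists>\<omega>\<in>set_pmf p. X \<omega> = x \<and> Z \<omega> = z"
  shows "sum_max p X Y (\<lambda>_. ()) \<le> sum_max p X Y Z"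
proof -
  have "ennreal (channel p X Y (\<lambda>_. ()) x y ()) \<le> (SUP x. ennreal (channel p X Y Z x y z))" for x y
  proof (cases "x \<in> X ` set_pmf p")
    case True
    then obtain \<omega> where "\<omega> \<in> set_pmf p" "X \<omega> = x" "Z \<omega> = z"
      using full by blast
    then have "measure p {\<omega>. X \<omega> = x \<and> Z \<omega> = z} > 0"
      by (intro measure_pmf_posI) auto
    then have "channel p X Y (\<lambda>_. ()) x y () = channel p X Y Z x y z"
      using channel_markov_input[OF M] by simp
    then show ?thesis
      by (auto intro: SUP_upper)
  next
    case False
    then have "measure p {\<omega>. X \<omega> = x} = 0"
      by (auto simp: measure_pmf_zero_iff)
    then show ?thesis
      by (simp add: channel_def)
  qed
  then have "sum_max_at p X Y (\<lambda>_. ()) () \<le> sum_max_at p X Y Z z"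
    unfolding sum_max_at_def[of p X Y Z] by (rule sum_max_at_leI)
  then show ?thesis
    unfolding sum_max_unit by (rule order.trans[OF _ sum_max_at_le])
qed

text \<open>From \<open>P(y, z|x) = P(z|x) P(y|x, z)\<close>: a maximum of products is at most the
  product of the maxima. The sum over \<open>y\<close> then gives the sum of maxima at
  \<open>z\<close>, and its supremum leaves the sum over \<open>z\<close> for the first
  factor.\<close>

lemma sum_max_pair_le:
  fixes Y :: "'w \<Rightarrow> 'y" and Z :: "'w \<Rightarrow> 'z"
  shows "sum_max p X (\<lambda>\<omega>. (Y \<omega>, Z \<omega>)) (\<lambda>_. ()) \<le> sum_max p X Z (\<lambda>_. ()) * sum_max p X Y Z"
proof -
  let ?A = "\<lambda>z. SUP x. ennreal (channel p X Z (\<lambda>_. ()) x z ())"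
  let ?B = "\<lambda>y z. SUP x. ennreal (channel p X Y Z x y z)"
  have factor: "channel p X (\<lambda>\<omega>. (Y \<omega>, Z \<omega>)) (\<lambda>_. ()) x (y, z) ()
      = channel p X Z (\<lambda>_. ()) x z () * channel p X Y Z x y z" for x y z
  proof (cases "measure p {\<omega>. X \<omega> = x \<and> Z \<omega> = z} = 0")
    case True
    have "measure p {\<omega>. X \<omega> = x \<and> Y \<omega> = y \<and> Z \<omega> = z} \<le> measure p {\<omega>. X \<omega> = x \<and> Z \<omega> = z}"
      by (rule measure_pmf.finite_measure_mono) auto
    then show ?thesis
      using True by (simp add: channel_def measure_le_0_iff)
  qed (simp add: channel_def conj_ac)
  have "sum_max p X (\<lambda>\<omega>. (Y \<omega>, Z \<omega>)) (\<lambda>_. ()) \<le> (\<integral>\<^sup>+w. ?A (snd w) * ?B (fst w) (snd w) \<partial>count_space UNIV)"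
    unfolding sum_max_unit
  proof (rule sum_max_at_leI)
    fix x and w :: "'y \<times> 'z"
    show "ennreal (channel p X (\<lambda>\<omega>. (Y \<omega>, Z \<omega>)) (\<lambda>_. ()) x w ()) \<le> ?A (snd w) * ?B (fst w) (snd w)"
      using factor[of x "fst w" "snd w"] by (auto simp: ennreal_mult intro!: mult_mono SUP_upper)
  qed
  also have "\<dots> = (\<integral>\<^sup>+z. \<integral>\<^sup>+y. ?A z * ?B y z \<partial>count_space UNIV \<partial>count_space UNIV)"
    using nn_integral_snd_count_space[of "\<lambda>w. ?A (snd w) * ?B (fst w) (snd w)"] by simp
  also have "\<dots> = (\<integral>\<^sup>+z. ?A z * sum_max_at p X Y Z z \<partial>count_space UNIV)"
    by (simp add: nn_integral_cmult sum_max_at_def)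
  also have "\<dots> \<le> (\<integral>\<^sup>+z. ?A z * sum_max p X Y Z \<partial>count_space UNIV)"
    by (intro nn_integral_mono mult_left_mono sum_max_at_le) simp
  also have "\<dots> = sum_max p X Z (\<lambda>_. ()) * sum_max p X Y Z"
    unfolding sum_max_unit[of p X Z] sum_max_at_def by (rule nn_integral_multc) simp
  finally show ?thesis .
qed

section \<open>Additivity\<close>

lemma SUP_mult_pair_ennreal:
  fixes f :: "'a \<Rightarrow> ennreal" and g :: "'b \<Rightarrow> ennreal"
  shows "(SUP w. f (fst w) * g (snd w)) = (SUP x. f x) * (SUP y. g y)"
proof (rule antisym)
  show "(SUP w. f (fst w) * g (snd w)) \<le> (SUP x. f x) * (SUP y. g y)"
    by (intro SUP_least mult_mono SUP_upper) auto
  show "(SUP x. f x) * (SUP y. g y) \<le> (SUP w. f (fst w) * g (snd w))"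
    unfolding SUP_mult_right_ennreal unfolding SUP_mult_left_ennreal
  proof (intro SUP_least)
    fix x y
    show "f x * g y \<le> (SUP w. f (fst w) * g (snd w))"
      by (rule SUP_upper2[of "(x, y)"]) auto
  qed
qed

lemma nn_integral_mult_pair_count_space:
  fixes f :: "'a \<Rightarrow> ennreal" and g :: "'b \<Rightarrow> ennreal"
  shows "(\<integral>\<^sup>+w. f (fst w) * g (snd w) \<partial>count_space UNIV)
    = (\<integral>\<^sup>+x. f x \<partial>count_space UNIV) * (\<integral>\<^sup>+y. g y \<partial>count_space UNIV)"
proof -
  have "(\<integral>\<^sup>+w. f (fst w) * g (snd w) \<partial>count_space UNIV)
      = (\<integral>\<^sup>+x. \<integral>\<^sup>+y. f x * g y \<partial>count_space UNIV \<partial>count_space UNIV)"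
    using nn_integral_fst_count_space[of "\<lambda>w. f (fst w) * g (snd w)"] by simp
  then show ?thesis
    by (simp add: nn_integral_cmult nn_integral_multc)
qed

text \<open>The channel of the pair is a product of channels in separate coordinates. The maximum
  over inputs, the sum over outputs and the supremum over the conditioning values each factor over
  such products.\<close>

lemma sum_max_independent_pair:
  fixes p :: "'w pmf"
  assumes indep: "\<And>x x' y y' z z'.
    measure p {\<omega>. (X \<omega> = x \<and> Z \<omega> = z \<and> Y \<omega> = y) \<and> (X' \<omega> = x' \<and> Z' \<omega> = z' \<and> Y' \<omega> = y')}
      = measure p {\<omega>. X \<omega> = x \<and> Z \<omega> = z \<and> Y \<omega> = y} * measure p {\<omega>. X' \<omega> = x' \<and> Z' \<omega> = z' \<and> Y' \<omega> = y'}"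
  shows "sum_max p (\<lambda>\<omega>. (X \<omega>, X' \<omega>)) (\<lambda>\<omega>. (Y \<omega>, Y' \<omega>)) (\<lambda>\<omega>. (Z \<omega>, Z' \<omega>))
    = sum_max p X Y Z * sum_max p X' Y' Z'"
proof -
  let ?X = "\<lambda>\<omega>. (X \<omega>, X' \<omega>)" and ?Y = "\<lambda>\<omega>. (Y \<omega>, Y' \<omega>)" and ?Z = "\<lambda>\<omega>. (Z \<omega>, Z' \<omega>)"
  have joint: "measure p {\<omega>. (?X \<omega> = x \<and> ?Z \<omega> = z) \<and> ?Y \<omega> = y}
      = measure p {\<omega>. (X \<omega> = fst x \<and> Z \<omega> = fst z) \<and> Y \<omega> = fst y}
        * measure p {\<omega>. (X' \<omega> = snd x \<and> Z' \<omega> = snd z) \<and> Y' \<omega> = snd y}" for x y z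
    using indep[of "fst x" "fst z" "fst y" "snd x" "snd z" "snd y"]
    by (auto simp: prod_eq_iff conj_ac)
  \<comment> \<open>Independence is given for full triples; summing over both outputs yields it for
    the inputs and conditioning values, the denominators of the channels.\<close>
  have input: "measure p {\<omega>. ?X \<omega> = x \<and> ?Z \<omega> = z}
      = measure p {\<omega>. X \<omega> = fst x \<and> Z \<omega> = fst z} * measure p {\<omega>. X' \<omega> = snd x \<and> Z' \<omega> = snd z}" for x z
  proof -
    have "ennreal (measure p {\<omega>. ?X \<omega> = x \<and> ?Z \<omega> = z})
        = (\<integral>\<^sup>+y. ennreal (measure p {\<omega>. (?X \<omega> = x \<and> ?Z \<omega> = z) \<and> ?Y \<omega> = y}) \<partial>count_space UNIV)"
      by (rule nn_integral_prob_slices[symmetric])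
    also have "\<dots> = (\<integral>\<^sup>+y. ennreal (measure p {\<omega>. (X \<omega> = fst x \<and> Z \<omega> = fst z) \<and> Y \<omega> = fst y})
        * ennreal (measure p {\<omega>. (X' \<omega> = snd x \<and> Z' \<omega> = snd z) \<and> Y' \<omega> = snd y}) \<partial>count_space UNIV)"
      unfolding joint by (simp add: ennreal_mult)
    also have "\<dots> = ennreal (measure p {\<omega>. X \<omega> = fst x \<and> Z \<omega> = fst z})
        * ennreal (measure p {\<omega>. X' \<omega> = snd x \<and> Z' \<omega> = snd z})"
      by (subst nn_integral_mult_pair_count_space) (simp only: nn_integral_prob_slices)
    finally show ?thesis
      by (simp add: ennreal_mult[symmetric])
  qed
  have ch: "ennreal (channel p ?X ?Y ?Z x y z)
      = ennreal (channel p X Y Z (fst x) (fst y) (fst z)) * ennreal (channel p X' Y' Z' (snd x) (snd y) (snd z))"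
    for x y z
    using joint[of x z y] input[of x z] unfolding channel_def conj_assoc by (simp add: ennreal_mult[symmetric])
  have at: "sum_max_at p ?X ?Y ?Z z = sum_max_at p X Y Z (fst z) * sum_max_at p X' Y' Z' (snd z)" for z
    unfolding sum_max_at_def ch
    by (simp only: SUP_mult_pair_ennreal[of "\<lambda>x. ennreal (channel p X Y Z x _ _)" "\<lambda>x. ennreal (channel p X' Y' Z' x _ _)"]
      nn_integral_mult_pair_count_space[of "\<lambda>y. SUP x. ennreal (channel p X Y Z x y _)"
        "\<lambda>y. SUP x. ennreal (channel p X' Y' Z' x y _)"])
  show ?thesis
    unfolding sum_max_def at
    by (rule SUP_mult_pair_ennreal)
qed

text \<open>Needed to identify a vector of length \<open>n + 1\<close> with the pair of its prefix
  and last entry. The maps are inverse only on attained values; a label not fixed by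
  \<open>f\<close> after \<open>g\<close> never occurs, so its channel entry is 0.\<close>

lemma sum_max_relabel_le:
  assumes X: "\<And>\<omega>. X' \<omega> = fX (X \<omega>)" "\<And>\<omega>. X \<omega> = gX (X' \<omega>)"
    and Y: "\<And>\<omega>. Y' \<omega> = fY (Y \<omega>)" "\<And>\<omega>. Y \<omega> = gY (Y' \<omega>)"
    and Z: "\<And>\<omega>. Z' \<omega> = fZ (Z \<omega>)" "\<And>\<omega>. Z \<omega> = gZ (Z' \<omega>)"
  shows "sum_max p X' Y' Z' \<le> sum_max p X Y Z"
proof -
  have ch: "channel p X' Y' Z' x y z = (if fX (gX x) = x \<and> fY (gY y) = y \<and> fZ (gZ z) = z
      then channel p X Y Z (gX x) (gY y) (gZ z) else 0)" for x y z
  proof (cases "fX (gX x) = x \<and> fY (gY y) = y \<and> fZ (gZ z) = z")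
    case True
    then have "X' \<omega> = x \<longleftrightarrow> X \<omega> = gX x" "Y' \<omega> = y \<longleftrightarrow> Y \<omega> = gY y" "Z' \<omega> = z \<longleftrightarrow> Z \<omega> = gZ z" for \<omega>
      using X[of \<omega>] Y[of \<omega>] Z[of \<omega>] by metis+
    then show ?thesis
      using True by (simp add: channel_def)
  next
    case False
    then have "\<not> (X' \<omega> = x \<and> Z' \<omega> = z \<and> Y' \<omega> = y)" for \<omega>
      using X[of \<omega>] Y[of \<omega>] Z[of \<omega>] by metis
    then have "{\<omega>. X' \<omega> = x \<and> Z' \<omega> = z \<and> Y' \<omega> = y} = {}"
      by blast
    then have "channel p X' Y' Z' x y z = 0"
      unfolding channel_def by (simp only: measure_empty div_0)
    then show ?thesis
      using False by auto
  qed
  have "sum_max_at p X' Y' Z' z \<le> sum_max_at p X Y Z (gZ z)" for z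
  proof -
    let ?G = "\<lambda>y. SUP x. ennreal (channel p X Y Z x y (gZ z))"
    let ?S = "{y. fY (gY y) = y}"
    have bij: "bij_betw gY ?S (gY ` ?S)"
      by (rule inj_on_imp_bij_betw, rule inj_on_inverseI[of _ fY]) simp
    \<comment> \<open>Outputs outside \<open>?S\<close> contribute 0. On \<open>?S\<close> the map
      \<open>gY\<close> is injective, so the sum can be reindexed as a part of the original
      one.\<close>
    have "sum_max_at p X' Y' Z' z \<le> (\<integral>\<^sup>+y. ?G (gY y) * indicator ?S y \<partial>count_space UNIV)"
      by (rule sum_max_at_leI) (auto simp: ch intro: SUP_upper)
    also have "\<dots> = (\<integral>\<^sup>+y. ?G (gY y) \<partial>count_space ?S)"
      by (simp add: nn_integral_count_space_indicator)
    also have "\<dots> = (\<integral>\<^sup>+y. ?G y \<partial>count_space (gY ` ?S))"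
      by (rule nn_integral_bij_count_space[OF bij])
    also have "\<dots> = (\<integral>\<^sup>+y. ?G y * indicator (gY ` ?S) y \<partial>count_space UNIV)"
      by (simp add: nn_integral_count_space_indicator)
    also have "\<dots> \<le> (\<integral>\<^sup>+y. ?G y \<partial>count_space UNIV)"
      by (intro nn_integral_mono) (auto simp: indicator_def)
    finally show ?thesis
      by (simp add: sum_max_at_def)
  qed
  then show ?thesis
    unfolding sum_max_def[of p X' Y' Z'] by (intro SUP_least) (rule order.trans[OF _ sum_max_at_le])
qed

lemma sum_max_relabel:
  assumes "\<And>\<omega>. X' \<omega> = fX (X \<omega>)" "\<And>\<omega>. X \<omega> = gX (X' \<omega>)"
    and "\<And>\<omega>. Y' \<omega> = fY (Y \<omega>)" "\<And>\<omega>. Y \<omega> = gY (Y' \<omega>)"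
    and "\<And>\<omega>. Z' \<omega> = fZ (Z \<omega>)" "\<And>\<omega>. Z \<omega> = gZ (Z' \<omega>)"
  shows "sum_max p X' Y' Z' = sum_max p X Y Z"
proof (rule antisym)
  show "sum_max p X' Y' Z' \<le> sum_max p X Y Z"
    by (rule sum_max_relabel_le) (fact assms)+
  show "sum_max p X Y Z \<le> sum_max p X' Y' Z'"
    by (rule sum_max_relabel_le) (fact assms)+
qed

lemma restrict_eq_iff: "g \<in> extensional A \<Longrightarrow> restrict f A = g \<longleftrightarrow> (\<forall>i\<in>A. f i = g i)"
  by (auto simp: fun_eq_iff extensional_def)

text \<open>\<open>N\<close> is kept apart from \<open>n\<close> so that the independence assumption
  stays fixed during the induction over prefixes.\<close>

lemma sum_max_independent_vector:
  fixes r :: "'s pmf" and Xs :: "nat \<Rightarrow> 's \<Rightarrow> 'a" and Ys :: "nat \<Rightarrow> 's \<Rightarrow> 'b" and Zs :: "nat \<Rightarrow> 's \<Rightarrow> 'c"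
  assumes "prob_space.indep_vars (measure_pmf r) (\<lambda>i. count_space UNIV) (\<lambda>i \<omega>. (Xs i \<omega>, Ys i \<omega>, Zs i \<omega>)) {1..N}"
    and "n \<le> N"
  shows "sum_max r (\<lambda>\<omega>. \<lambda>i\<in>{1..n}. Xs i \<omega>) (\<lambda>\<omega>. \<lambda>i\<in>{1..n}. Ys i \<omega>) (\<lambda>\<omega>. \<lambda>i\<in>{1..n}. Zs i \<omega>)
    = (\<Prod>i=1..n. sum_max r (Xs i) (Ys i) (Zs i))"
proof -
  have prefix_prob: "measure r {\<omega>. \<forall>i\<in>{1..n}. Xs i \<omega> = x i \<and> Ys i \<omega> = y i \<and> Zs i \<omega> = z i}
      = (\<Prod>i=1..n. measure r {\<omega>. Xs i \<omega> = x i \<and> Ys i \<omega> = y i \<and> Zs i \<omega> = z i})"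
    if "n \<le> N" for n x y z
  \<comment> \<open>\<open>indep_varsD\<close> requires a nonempty index set; for
    \<open>n = 0\<close> both sides are 1.\<close>
  proof (cases "n = 0")
    case False
    have "measure r (\<Inter>i\<in>{1..n}. (\<lambda>\<omega>. (Xs i \<omega>, Ys i \<omega>, Zs i \<omega>)) -` {(x i, y i, z i)} \<inter> space (measure_pmf r))
        = (\<Prod>i=1..n. measure r ((\<lambda>\<omega>. (Xs i \<omega>, Ys i \<omega>, Zs i \<omega>)) -` {(x i, y i, z i)} \<inter> space (measure_pmf r)))"
      using False that by (intro prob_space.indep_varsD[OF measure_pmf.prob_space_axioms assms(1)]) auto
    moreover have "(\<Inter>i\<in>{1..n}. (\<lambda>\<omega>. (Xs i \<omega>, Ys i \<omega>, Zs i \<omega>)) -` {(x i, y i, z i)} \<inter> space (measure_pmf r))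
        = {\<omega>. \<forall>i\<in>{1..n}. Xs i \<omega> = x i \<and> Ys i \<omega> = y i \<and> Zs i \<omega> = z i}"
      using False by auto
    moreover have "(\<lambda>\<omega>. (Xs i \<omega>, Ys i \<omega>, Zs i \<omega>)) -` {(x i, y i, z i)} \<inter> space (measure_pmf r)
        = {\<omega>. Xs i \<omega> = x i \<and> Ys i \<omega> = y i \<and> Zs i \<omega> = z i}" for i
      by auto
    ultimately show ?thesis by simp
  qed simp
  show ?thesis
    using assms(2)
  proof (induction n)
    case 0
    \<comment> \<open>The empty vector takes a single value, so the bound by the size of the input
      alphabet is 1 and matches the lower bound.\<close>
    have "sum_max r (\<lambda>\<omega>. \<lambda>i\<in>{1..0::nat}. Xs i \<omega>) (\<lambda>\<omega>. \<lambda>i\<in>{1..0::nat}. Ys i \<omega>) (\<lambda>\<omega>. \<lambda>i\<in>{1..0::nat}. Zs i \<omega>)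
        \<le> of_nat (card {\<lambda>i :: nat. undefined :: 'a})"
      by (intro sum_max_le_card) auto
    then show ?case
      by (intro antisym) (simp_all add: sum_max_ge_1 restrict_def)
  next
    case (Suc n)
    let ?XS = "\<lambda>\<omega>. \<lambda>i\<in>{1..n}. Xs i \<omega>" and ?YS = "\<lambda>\<omega>. \<lambda>i\<in>{1..n}. Ys i \<omega>" and ?ZS = "\<lambda>\<omega>. \<lambda>i\<in>{1..n}. Zs i \<omega>"
    let ?m = "Suc n"
    let ?glue = "\<lambda>w. (fst w)(?m := snd w)"
    let ?cut = "\<lambda>f. (restrict f {1..n}, f ?m)"
    have glue: "(\<lambda>i\<in>{1..?m}. h i) = ?glue (restrict h {1..n}, h ?m)" for h :: "nat \<Rightarrow> 'd"
      by (auto simp: fun_eq_iff)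
    have cut: "(restrict h {1..n}, h ?m) = ?cut (\<lambda>i\<in>{1..?m}. h i)" for h :: "nat \<Rightarrow> 'd"
      by (auto simp: fun_eq_iff)
    have "sum_max r (\<lambda>\<omega>. \<lambda>i\<in>{1..?m}. Xs i \<omega>) (\<lambda>\<omega>. \<lambda>i\<in>{1..?m}. Ys i \<omega>) (\<lambda>\<omega>. \<lambda>i\<in>{1..?m}. Zs i \<omega>)
        = sum_max r (\<lambda>\<omega>. (?XS \<omega>, Xs ?m \<omega>)) (\<lambda>\<omega>. (?YS \<omega>, Ys ?m \<omega>)) (\<lambda>\<omega>. (?ZS \<omega>, Zs ?m \<omega>))"
      by (rule sum_max_relabel[of _ ?glue _ ?cut _ ?glue _ ?cut _ ?glue _ ?cut]) (rule glue cut)+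
    also have "\<dots> = sum_max r ?XS ?YS ?ZS * sum_max r (Xs ?m) (Ys ?m) (Zs ?m)"
    proof (rule sum_max_independent_pair)
      fix f x g y h z
      let ?A = "{\<omega>. ?XS \<omega> = f \<and> ?ZS \<omega> = h \<and> ?YS \<omega> = g}"
      let ?B = "{\<omega>. Xs ?m \<omega> = x \<and> Zs ?m \<omega> = z \<and> Ys ?m \<omega> = y}"
      let ?AB = "{\<omega>. (?XS \<omega> = f \<and> ?ZS \<omega> = h \<and> ?YS \<omega> = g) \<and> (Xs ?m \<omega> = x \<and> Zs ?m \<omega> = z \<and> Ys ?m \<omega> = y)}"
      show "measure r ?AB = measure r ?A * measure r ?B"
      \<comment> \<open>A restricted function is extensional, so any other \<open>f\<close>,
        \<open>g\<close> or \<open>h\<close> is never attained and both sides are 0.\<close>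
      proof (cases "f \<in> extensional {1..n} \<and> g \<in> extensional {1..n} \<and> h \<in> extensional {1..n}")
        case True
        let ?f = "f(?m := x)" and ?g = "g(?m := y)" and ?h = "h(?m := z)"
        have A: "?A = {\<omega>. \<forall>i\<in>{1..n}. Xs i \<omega> = ?f i \<and> Ys i \<omega> = ?g i \<and> Zs i \<omega> = ?h i}"
          using True by (auto simp: restrict_eq_iff)
        have B: "?B = {\<omega>. Xs ?m \<omega> = ?f ?m \<and> Ys ?m \<omega> = ?g ?m \<and> Zs ?m \<omega> = ?h ?m}"
          by auto
        have AB: "?AB = {\<omega>. \<forall>i\<in>{1..?m}. Xs i \<omega> = ?f i \<and> Ys i \<omega> = ?g i \<and> Zs i \<omega> = ?h i}"
          using True by (auto simp: restrict_eq_iff atLeastAtMostSuc_conv)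
        show ?thesis
          unfolding A B AB using Suc.prems
          by (subst (1 2) prefix_prob) (simp_all del: fun_upd_apply)
      next
        case False
        then have "?A = {}" "?AB = {}"
          by auto
        then show ?thesis
          by (simp only: measure_empty mult_zero_left)
      qed
    qed
    also have "sum_max r ?XS ?YS ?ZS = (\<Prod>i=1..n. sum_max r (Xs i) (Ys i) (Zs i))"
      using Suc.prems by (intro Suc.IH) simp
    also have "(\<Prod>i=1..n. sum_max r (Xs i) (Ys i) (Zs i)) * sum_max r (Xs ?m) (Ys ?m) (Zs ?m)
        = (\<Prod>i=1..?m. sum_max r (Xs i) (Ys i) (Zs i))"
      by simp
    finally show ?case .
  qed
qed

section \<open>Mutual information and asymmetry\<close>

lemma distributed_count_space:
  assumes "finite A" "X \<in> UNIV \<rightarrow> A"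
  shows "distributed (measure_pmf p) (count_space A) X (\<lambda>a. ennreal (measure p {\<omega>. X \<omega> = a}))"
  unfolding distributed_def
proof (intro conjI)
  have meas: "X \<in> measure_pmf p \<rightarrow>\<^sub>M count_space A"
    using assms(2) by (auto simp: measurable_def)
  then show "X \<in> measure_pmf p \<rightarrow>\<^sub>M count_space A" .
  show "distr (measure_pmf p) (count_space A) X = density (count_space A) (\<lambda>a. ennreal (measure p {\<omega>. X \<omega> = a}))"
  proof (rule measure_eqI_finite[of _ A])
    fix a assume "a \<in> A"
    then show "emeasure (distr (measure_pmf p) (count_space A) X) {a}
        = emeasure (density (count_space A) (\<lambda>a. ennreal (measure p {\<omega>. X \<omega> = a}))) {a}"
      using assms(1)
      by (simp add: emeasure_distr[OF meas] emeasure_density nn_integral_count_space_finite measure_pmf.emeasure_eq_measure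
        vimage_def indicator_def if_distrib sum.delta cong: if_cong)
  qed (use assms(1) in auto)
qed simp

text \<open>On finite counting spaces the densities are point probabilities and the integral is a
  finite sum. The events are ordered to match those of the channel.\<close>

lemma cond_mutual_info_eq:
  fixes p :: "'w pmf"
  assumes fin: "finite \<X>" "finite \<Y>" "finite \<Z>"
    and ran: "X \<in> UNIV \<rightarrow> \<X>" "Y \<in> UNIV \<rightarrow> \<Y>" "Z \<in> UNIV \<rightarrow> \<Z>"
  shows "cond_mutual_info p \<X> \<Y> \<Z> X Y Z =
    (\<Sum>(x, y, z)\<in>\<X> \<times> \<Y> \<times> \<Z>. measure p {\<omega>. X \<omega> = x \<and> Z \<omega> = z \<and> Y \<omega> = y} *
       ln (measure p {\<omega>. X \<omega> = x \<and> Z \<omega> = z \<and> Y \<omega> = y} /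
           (measure p {\<omega>. X \<omega> = x \<and> Z \<omega> = z} *
            (measure p {\<omega>. Z \<omega> = z \<and> Y \<omega> = y} / measure p {\<omega>. Z \<omega> = z}))))"
proof -
  interpret I: information_space "measure_pmf p" "exp 1 :: real"
    by unfold_locales simp
  let ?Px = "\<lambda>x. measure p {\<omega>. X \<omega> = x}" and ?Pz = "\<lambda>z. measure p {\<omega>. Z \<omega> = z}"
  let ?Pyz = "\<lambda>w. measure p {\<omega>. (Y \<omega>, Z \<omega>) = w}" and ?Pxz = "\<lambda>w. measure p {\<omega>. (X \<omega>, Z \<omega>) = w}"
  let ?Pxyz = "\<lambda>w. measure p {\<omega>. (X \<omega>, Y \<omega>, Z \<omega>) = w}"
  note [simp] = pair_measure_count_space fin finite_cartesian_product
  have dist: "distributed (measure_pmf p) (count_space \<X>) X ?Px"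
    "distributed (measure_pmf p) (count_space \<Z>) Z ?Pz"
    "distributed (measure_pmf p) (count_space \<Y> \<Otimes>\<^sub>M count_space \<Z>) (\<lambda>\<omega>. (Y \<omega>, Z \<omega>)) ?Pyz"
    "distributed (measure_pmf p) (count_space \<X> \<Otimes>\<^sub>M count_space \<Z>) (\<lambda>\<omega>. (X \<omega>, Z \<omega>)) ?Pxz"
    "distributed (measure_pmf p) (count_space \<X> \<Otimes>\<^sub>M count_space \<Y> \<Otimes>\<^sub>M count_space \<Z>)
       (\<lambda>\<omega>. (X \<omega>, Y \<omega>, Z \<omega>)) ?Pxyz"
    using ran by (auto intro!: distributed_count_space)
  have "cond_mutual_info p \<X> \<Y> \<Z> X Y Z = (\<integral>(x, y, z). ?Pxyz (x, y, z) *
      log (exp 1) (?Pxyz (x, y, z) / (?Pxz (x, z) * (?Pyz (y, z) / ?Pz z)))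
      \<partial>(count_space \<X> \<Otimes>\<^sub>M count_space \<Y> \<Otimes>\<^sub>M count_space \<Z>))"
    by (rule I.conditional_mutual_information_generic_eq[OF _ _ _ dist(1) _ dist(2) _ dist(3) _ dist(4) _ dist(5)])
      (auto intro: sigma_finite_measure_count_space_finite integrable_count_space)
  also have "\<dots> = (\<Sum>(x, y, z)\<in>\<X> \<times> \<Y> \<times> \<Z>. ?Pxyz (x, y, z) *
      ln (?Pxyz (x, y, z) / (?Pxz (x, z) * (?Pyz (y, z) / ?Pz z))))"
    by (simp add: lebesgue_integral_count_space_finite log_def)
  finally show ?thesis
    by (simp add: conj_ac)
qed

lemma sum_max_at_ge_sum:
  assumes "finite \<Y>"
  shows "(\<Sum>y\<in>\<Y>. SUP x. ennreal (channel p X Y Z x y z)) \<le> sum_max_at p X Y Z z"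
proof -
  let ?G = "\<lambda>y. SUP x. ennreal (channel p X Y Z x y z)"
  have "(\<Sum>y\<in>\<Y>. ?G y) = (\<integral>\<^sup>+y. ?G y \<partial>count_space \<Y>)"
    using assms by (simp add: nn_integral_count_space_finite)
  also have "\<dots> = (\<integral>\<^sup>+y. ?G y * indicator \<Y> y \<partial>count_space UNIV)"
    by (simp add: nn_integral_count_space_indicator)
  also have "\<dots> \<le> sum_max_at p X Y Z z"
    unfolding sum_max_at_def by (intro nn_integral_mono) (auto simp: indicator_def)
  finally show ?thesis .
qed

text \<open>The tangent to \<open>ln\<close> at \<open>c\<close>, weighted by \<open>f\<close>.
  Summed against a probability distribution it yields Jensen's inequality.\<close>

lemma mult_ln_le:
  fixes f r c :: real
  assumes "0 \<le> f" "0 < r" "0 < c"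
  shows "f * ln r \<le> f * r / c + f * (ln c - 1)"
proof -
  have "ln r = ln (r / c) + ln c"
    using assms by (simp add: ln_div)
  also have "ln (r / c) \<le> r / c - 1"
    using assms by (intro ln_le_minus_one) simp
  finally have "f * ln r \<le> f * (r / c - 1 + ln c)"
    using assms(1) by (intro mult_left_mono) simp_all
  then show ?thesis
    by (simp add: algebra_simps)
qed

text \<open>The information is the mean of \<open>ln r\<close> with
  \<open>r = P(y|x, z) / P(y|z)\<close>. By concavity it suffices that the mean of \<open>r\<close>
  is at most \<open>c\<close>: replacing \<open>P(y|x, z)\<close> by its maximum
  \<open>g y z\<close> cancels \<open>P(y|z)\<close> after summing over \<open>x\<close>, leaving a
  \<open>z\<close>-average of sums of maxima.\<close>

lemma cond_mutual_info_le_ln_sum_max: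
  fixes p :: "'w pmf"
  assumes fin: "finite \<X>" "finite \<Y>" "finite \<Z>"
    and ran: "X \<in> UNIV \<rightarrow> \<X>" "Y \<in> UNIV \<rightarrow> \<Y>" "Z \<in> UNIV \<rightarrow> \<Z>"
  shows "cond_mutual_info p \<X> \<Y> \<Z> X Y Z \<le> ln (enn2real (sum_max p X Y Z))"
proof -
  define c where "c = enn2real (sum_max p X Y Z)"
  have "finite (X ` set_pmf p)"
    using ran(1) by (intro finite_subset[OF _ fin(1)]) auto
  from enn2real_sum_max[OF this, of Y Z] have c: "sum_max p X Y Z = ennreal c" "1 \<le> c"
    by (simp_all add: c_def)
  let ?f = "\<lambda>x y z. measure p {\<omega>. X \<omega> = x \<and> Z \<omega> = z \<and> Y \<omega> = y}"
  let ?xz = "\<lambda>x z. measure p {\<omega>. X \<omega> = x \<and> Z \<omega> = z}"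
  let ?yz = "\<lambda>y z. measure p {\<omega>. Z \<omega> = z \<and> Y \<omega> = y}"
  let ?z = "\<lambda>z. measure p {\<omega>. Z \<omega> = z}"
  let ?r = "\<lambda>x y z. ?f x y z / (?xz x z * (?yz y z / ?z z))"
  let ?A = "\<X> \<times> \<Y> \<times> \<Z>"
  define g where "g y z = enn2real (SUP x. ennreal (channel p X Y Z x y z))" for y z
  have g: "ennreal (g y z) = (SUP x. ennreal (channel p X Y Z x y z))" "0 \<le> g y z" for y z
  proof -
    have "(SUP x. ennreal (channel p X Y Z x y z)) \<le> 1"
      by (intro SUP_least) (simp add: channel_le_1)
    then show "ennreal (g y z) = (SUP x. ennreal (channel p X Y Z x y z))"
      by (simp add: g_def le_less_trans)
  qed (simp add: g_def)
  have ch_le: "channel p X Y Z x y z \<le> g y z" for x y z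
  proof -
    have "ennreal (channel p X Y Z x y z) \<le> ennreal (g y z)"
      unfolding g by (rule SUP_upper) simp
    then show ?thesis using g(2) by simp
  qed
  have g_sum: "(\<Sum>y\<in>\<Y>. g y z) \<le> c" for z
  proof -
    have "ennreal (\<Sum>y\<in>\<Y>. g y z) = (\<Sum>y\<in>\<Y>. ennreal (g y z))"
      using g(2) by (simp add: sum_ennreal)
    also have "\<dots> \<le> ennreal c"
      unfolding g c(1)[symmetric] by (rule order.trans[OF sum_max_at_ge_sum[OF fin(2)] sum_max_at_le])
    finally show ?thesis
      using c(2) by simp
  qed
  have slices: "(\<Sum>a\<in>A. measure p {\<omega>. Q \<omega> \<and> W \<omega> = a}) = measure p {\<omega>. Q \<omega>}"
    if A: "finite A" "W \<in> UNIV \<rightarrow> A" for A Q and W :: "'w \<Rightarrow> 'v"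
  proof -
    have "measure p (\<Union>a\<in>A. {\<omega>. Q \<omega> \<and> W \<omega> = a}) = (\<Sum>a\<in>A. measure p {\<omega>. Q \<omega> \<and> W \<omega> = a})"
      by (rule measure_pmf.finite_measure_finite_Union) (auto simp: A disjoint_family_on_def)
    moreover have "(\<Union>a\<in>A. {\<omega>. Q \<omega> \<and> W \<omega> = a}) = {\<omega>. Q \<omega>}"
      using A by auto
    ultimately show ?thesis by simp
  qed
  have total: "(\<Sum>(x, y, z)\<in>?A. ?f x y z) = 1"
  proof -
    have "(\<Sum>(x, y, z)\<in>?A. ?f x y z) = (\<Sum>w\<in>?A. measure p {\<omega>. True \<and> (X \<omega>, Y \<omega>, Z \<omega>) = w})"
      by (intro sum.cong) (auto intro!: arg_cong[where f = "measure (measure_pmf p)"])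
    also have "\<dots> = measure p {\<omega>. True}"
      using fin ran by (intro slices) auto
    finally show ?thesis by simp
  qed
  have ratio_total: "(\<Sum>(x, y, z)\<in>?A. ?f x y z * ?r x y z) \<le> c"
  proof -
    have "?f x y z * ?r x y z \<le> ?f x y z * (g y z * (?z z / ?yz y z))" for x y z
    proof -
      have "?r x y z = channel p X Y Z x y z * (?z z / ?yz y z)"
        by (simp add: channel_def)
      then show ?thesis
        using ch_le by (simp only:) (intro mult_left_mono mult_right_mono; simp)
    qed
    then have "(\<Sum>(x, y, z)\<in>?A. ?f x y z * ?r x y z) \<le> (\<Sum>(x, y, z)\<in>?A. ?f x y z * (g y z * (?z z / ?yz y z)))"
      by (intro sum_mono) auto
    also have "\<dots> = (\<Sum>x\<in>\<X>. \<Sum>(y, z)\<in>\<Y> \<times> \<Z>. ?f x y z * (g y z * (?z z / ?yz y z)))"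
      by (subst sum.cartesian_product) (simp only: case_prod_beta)
    also have "\<dots> = (\<Sum>(y, z)\<in>\<Y> \<times> \<Z>. \<Sum>x\<in>\<X>. ?f x y z * (g y z * (?z z / ?yz y z)))"
      by (subst sum.swap) (simp only: split_def)
    also have "\<dots> = (\<Sum>(y, z)\<in>\<Y> \<times> \<Z>. ?yz y z * (g y z * (?z z / ?yz y z)))"
    proof (intro sum.cong refl, clarify)
      fix y z
      have "(\<Sum>x\<in>\<X>. ?f x y z) = ?yz y z"
        using slices[OF fin(1) ran(1), of "\<lambda>\<omega>. Z \<omega> = z \<and> Y \<omega> = y"] by (simp add: conj_ac)
      then show "(\<Sum>x\<in>\<X>. ?f x y z * (g y z * (?z z / ?yz y z))) = ?yz y z * (g y z * (?z z / ?yz y z))"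
        by (simp only: sum_distrib_right[symmetric])
    qed
    \<comment> \<open>Equality holds where \<open>P(y, z) > 0\<close>; elsewhere division by zero
      makes the left term 0.\<close>
    also have "\<dots> \<le> (\<Sum>(y, z)\<in>\<Y> \<times> \<Z>. g y z * ?z z)"
      using g(2) by (intro sum_mono) (auto simp: field_simps)
    also have "\<dots> = (\<Sum>z\<in>\<Z>. (\<Sum>y\<in>\<Y>. g y z) * ?z z)"
      unfolding sum.cartesian_product[symmetric] sum_distrib_right by (rule sum.swap)
    also have "\<dots> \<le> (\<Sum>z\<in>\<Z>. c * ?z z)"
      by (intro sum_mono mult_right_mono g_sum) simp
    also have "\<dots> = c"
      using slices[OF fin(3) ran(3), of "\<lambda>_. True"] by (simp add: sum_distrib_left[symmetric])
    finally show ?thesis .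
  qed
  have pointwise: "?f x y z * ln (?r x y z) \<le> ?f x y z * ?r x y z / c + ?f x y z * (ln c - 1)" for x y z
  proof (cases "?f x y z = 0")
    case False
    then have f: "?f x y z > 0"
      by (simp add: less_le)
    have "?f x y z \<le> ?xz x z" "?f x y z \<le> ?yz y z" "?f x y z \<le> ?z z"
      by (auto intro!: measure_pmf.finite_measure_mono)
    then have "?r x y z > 0"
      using f by (intro divide_pos_pos mult_pos_pos) auto
    then show ?thesis
      using c(2) by (intro mult_ln_le) auto
  qed simp
  have "cond_mutual_info p \<X> \<Y> \<Z> X Y Z = (\<Sum>(x, y, z)\<in>?A. ?f x y z * ln (?r x y z))"
    by (rule cond_mutual_info_eq[OF fin ran])
  also have "\<dots> \<le> (\<Sum>(x, y, z)\<in>?A. ?f x y z * ?r x y z / c + ?f x y z * (ln c - 1))"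
    using pointwise by (intro sum_mono) (simp only: split_def)
  also have "\<dots> = (\<Sum>(x, y, z)\<in>?A. ?f x y z * ?r x y z) / c + (\<Sum>(x, y, z)\<in>?A. ?f x y z) * (ln c - 1)"
    by (simp only: split_def sum.distrib sum_divide_distrib sum_distrib_right)
  \<comment> \<open>Taking the tangent at the bound \<open>c\<close> itself makes the constants
    cancel to \<open>ln c\<close>.\<close>
  also have "\<dots> \<le> 1 + 1 * (ln c - 1)"
    unfolding total using ratio_total c(2) by (intro add_right_mono) (simp add: divide_le_eq_1)
  finally show ?thesis
    by (simp add: c_def)
qed

text \<open>With \<open>C\<close> constant, let \<open>(A, B)\<close> be \<open>(0, 0)\<close>,
  \<open>(1, 0)\<close>, \<open>(1, 1)\<close> with probabilities 1/2, 1/4, 1/4. From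
  \<open>A\<close> to \<open>B\<close> the maxima are 1 and 1/2, with sum 3/2; from \<open>B\<close>
  to \<open>A\<close> they are 2/3 and 1, with sum 5/3.\<close>

lemma cond_max_leakage_not_symmetric:
  "\<exists>(q :: (nat \<times> nat \<times> nat) pmf) (A :: nat \<times> nat \<times> nat \<Rightarrow> nat) (B :: nat \<times> nat \<times> nat \<Rightarrow> nat)
      (C :: nat \<times> nat \<times> nat \<Rightarrow> nat).
    finite (range A) \<and> finite (range B) \<and> finite (range C) \<and>
    cond_max_leakage q A B C \<noteq> cond_max_leakage q B A C"
proof -
  define q where "q = map_pmf (\<lambda>a. (a, 0 :: nat, 0 :: nat)) (pmf_of_set {..<4 :: nat})"
  define A B C :: "nat \<times> nat \<times> nat \<Rightarrow> nat" where "A = (\<lambda>\<omega>. if fst \<omega> < 2 then 0 else 1)"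
    and "B = (\<lambda>\<omega>. if fst \<omega> = 3 then 1 else 0)" and "C = (\<lambda>_. 0)"
  have fin: "finite (range A)" "finite (range B)" "finite (range C)"
    by (rule finite_subset[of _ "{0, 1}"]; auto simp: A_def B_def C_def)+
  have prob: "measure q {\<omega>. P \<omega>} = real (card ({a. P (a, 0, 0)} \<inter> {0, 1, 2, 3})) / 4" for P
  proof -
    have "{..<4 :: nat} = {0, 1, 2, 3}" by auto
    then show ?thesis
      by (simp add: q_def vimage_def measure_pmf_of_set Int_commute)
  qed
  have ge: "ennreal (5 / 3) \<le> sum_max q B A C"
  proof -
    have ch: "channel q B A C 0 0 0 = 2 / 3" "channel q B A C 1 1 0 = 1"
      unfolding channel_def prob by (simp_all add: A_def B_def C_def Int_insert_right)
    then have "ennreal (5 / 3) = ennreal (channel q B A C 0 0 0) + ennreal (channel q B A C 1 1 0)"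
      unfolding ch by (subst ennreal_plus[symmetric]) simp_all
    also have "\<dots> \<le> (\<Sum>y\<in>{0, 1}. SUP x. ennreal (channel q B A C x y 0))"
      using SUP_upper[of 0 UNIV "\<lambda>x. ennreal (channel q B A C x 0 0)"]
        SUP_upper[of 1 UNIV "\<lambda>x. ennreal (channel q B A C x 1 0)"]
      by (simp add: add_mono)
    also have "\<dots> \<le> sum_max_at q B A C 0"
      by (rule sum_max_at_ge_sum) simp
    also note sum_max_at_le
    finally show ?thesis .
  qed
  have le: "sum_max q A B C \<le> ennreal (3 / 2)"
    unfolding sum_max_def
  proof (rule SUP_least)
    fix z
    have bound: "channel q A B C x y z \<le> (if y = 0 then 1 else if y = 1 then 1 / 2 else 0)" for x y
    proof -
      have "channel q A B C x 1 z \<le> 1 / 2"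
        unfolding channel_def prob
        by (cases "x = 0"; cases "x = 1"; cases "z = 0") (simp_all add: A_def B_def C_def Int_insert_right)
      moreover have "channel q A B C x y z = 0" if "y \<noteq> 0" "y \<noteq> 1"
      proof -
        have "{\<omega>. A \<omega> = x \<and> C \<omega> = z \<and> B \<omega> = y} = {}"
          using that by (auto simp: B_def)
        then show ?thesis
          unfolding channel_def by (simp only: measure_empty div_0)
      qed
      ultimately show ?thesis
        by (simp add: channel_le_1)
    qed
    have "sum_max_at q A B C z \<le> (\<integral>\<^sup>+(y :: nat). ennreal (if y = 0 then 1 else if y = 1 then 1 / 2 else 0) \<partial>count_space UNIV)"
      by (intro sum_max_at_leI ennreal_leI bound)
    also have "\<dots> = (\<Sum>y\<in>{0, 1 :: nat}. ennreal (if y = 0 then 1 else if y = 1 then 1 / 2 else 0))"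
      by (rule nn_integral_count_space') (auto split: if_splits)
    also have "\<dots> = ennreal (3 / 2)"
      by (simp add: ennreal_plus[symmetric] flip: ennreal_1 del: ennreal_plus)
    finally show "sum_max_at q A B C z \<le> ennreal (3 / 2)" .
  qed
  have "cond_max_leakage q A B C \<noteq> cond_max_leakage q B A C"
  proof
    assume eq: "cond_max_leakage q A B C = cond_max_leakage q B A C"
    have supp: "finite (A ` set_pmf q)" "finite (B ` set_pmf q)"
      using fin by (auto intro: finite_subset[rotated])
    have "sum_max q B A C \<le> ennreal (3 / 2)"
      using cond_max_leakage_le_iff[OF supp(1), of "3 / 2" B C] cond_max_leakage_le_iff[OF supp(2), of "3 / 2" A C] le eq
      by simp
    then have "ennreal (5 / 3) \<le> ennreal (3 / 2)"
      by (rule order.trans[OF ge])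
    then show False by simp
  qed
  then show ?thesis
    using fin by blast
qed

text \<open>The logarithm turns the product of sums of maxima into a sum; every factor is at least
  1, so no logarithm degenerates.\<close>

lemma cond_max_leakage_independent_vector:
  fixes r :: "'s pmf" and Xs :: "nat \<Rightarrow> 's \<Rightarrow> 'a" and Ys :: "nat \<Rightarrow> 's \<Rightarrow> 'b" and Zs :: "nat \<Rightarrow> 's \<Rightarrow> 'c"
  assumes fin: "\<And>i. i \<in> {1..n} \<Longrightarrow> finite (range (Xs i))"
    and indep: "prob_space.indep_vars (measure_pmf r) (\<lambda>i. count_space UNIV) (\<lambda>i \<omega>. (Xs i \<omega>, Ys i \<omega>, Zs i \<omega>)) {1..n}"
  shows "cond_max_leakage r (\<lambda>\<omega>. \<lambda>i\<in>{1..n}. Xs i \<omega>) (\<lambda>\<omega>. \<lambda>i\<in>{1..n}. Ys i \<omega>) (\<lambda>\<omega>. \<lambda>i\<in>{1..n}. Zs i \<omega>)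
    = (\<Sum>i=1..n. cond_max_leakage r (Xs i) (Ys i) (Zs i))"
proof -
  define k where "k i = enn2real (sum_max r (Xs i) (Ys i) (Zs i))" for i
  have supp: "finite (Xs i ` set_pmf r)" if "i \<in> {1..n}" for i
    using fin[OF that] by (rule finite_subset[rotated]) auto
  have k: "sum_max r (Xs i) (Ys i) (Zs i) = ennreal (k i)" "1 \<le> k i" if "i \<in> {1..n}" for i
    using enn2real_sum_max[OF supp[OF that], of "Ys i" "Zs i"] by (simp_all add: k_def)
  have "finite (PiE {1..n} (\<lambda>i. range (Xs i)))"
    using fin by (intro finite_PiE) auto
  then have "finite ((\<lambda>\<omega>. \<lambda>i\<in>{1..n}. Xs i \<omega>) ` set_pmf r)"
    by (rule finite_subset[rotated]) auto
  then have "cond_max_leakage r (\<lambda>\<omega>. \<lambda>i\<in>{1..n}. Xs i \<omega>) (\<lambda>\<omega>. \<lambda>i\<in>{1..n}. Ys i \<omega>) (\<lambda>\<omega>. \<lambda>i\<in>{1..n}. Zs i \<omega>)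
      = ereal (ln (enn2real (\<Prod>i=1..n. sum_max r (Xs i) (Ys i) (Zs i))))"
    unfolding sum_max_independent_vector[OF indep order_refl, symmetric] by (rule cond_max_leakage_eq)
  also have "(\<Prod>i=1..n. sum_max r (Xs i) (Ys i) (Zs i)) = (\<Prod>i=1..n. ennreal (k i))"
    using k(1) by (rule prod.cong[OF refl])
  also have "\<dots> = ennreal (\<Prod>i=1..n. k i)"
    by (rule prod_ennreal) (use k(2) in force)
  also have "enn2real (ennreal (\<Prod>i=1..n. k i)) = (\<Prod>i=1..n. k i)"
    by (rule enn2real_ennreal, rule prod_nonneg) (use k(2) in force)
  also have "ln (\<Prod>i=1..n. k i) = (\<Sum>i=1..n. ln (k i))"
    by (rule ln_prod) (use k(2) in force)+
  also have "ereal (\<Sum>i=1..n. ln (k i)) = (\<Sum>i=1..n. cond_max_leakage r (Xs i) (Ys i) (Zs i))"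
    unfolding sum_ereal[symmetric] by (rule sum.cong[OF refl]) (simp add: k_def cond_max_leakage_eq[OF supp])
  finally show ?thesis .
qed

section \<open>Assembly of the eight claims\<close>

theorem corollary2:
  fixes p :: "'w pmf"
    and X :: "'w \<Rightarrow> 'x" and Y :: "'w \<Rightarrow> 'y" and Z :: "'w \<Rightarrow> 'z"
    and \<X> :: "'x set" and \<Y> :: "'y set" and \<Z> :: "'z set"
  assumes "finite \<X>" and "finite \<Y>" and "finite \<Z>"
    and "X \<in> UNIV \<rightarrow> \<X>" and "Y \<in> UNIV \<rightarrow> \<Y>" and "Z \<in> UNIV \<rightarrow> \<Z>"
  shows
    "(\<forall>V :: 'w \<Rightarrow> 'v. markov_chain_given p X Y V Z \<longrightarrow>
        cond_max_leakage p X V Z \<le> min (cond_max_leakage p X Y Z) (cond_max_leakage p Y V Z))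
   \<and> cond_max_leakage p X Y Z \<le> min (ereal (ln (real (card \<X>)))) (ereal (ln (real (card \<Y>))))
   \<and> (cond_max_leakage p X Y Z = 0 \<longleftrightarrow> markov_chain p X Z Y)
   \<and> (\<forall>(n :: nat) (r :: 's pmf) (Xs :: nat \<Rightarrow> 's \<Rightarrow> 'a) (Ys :: nat \<Rightarrow> 's \<Rightarrow> 'b) (Zs :: nat \<Rightarrow> 's \<Rightarrow> 'c).
        n \<ge> 1 \<and>
        (\<forall>i\<in>{1..n}. finite (range (Xs i)) \<and> finite (range (Ys i)) \<and> finite (range (Zs i))) \<and>
        prob_space.indep_vars (measure_pmf r) (\<lambda>i. count_space UNIV)
          (\<lambda>i \<omega>. (Xs i \<omega>, Ys i \<omega>, Zs i \<omega>)) {1..n} \<longrightarrow>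
        cond_max_leakage r (\<lambda>\<omega>. \<lambda>i\<in>{1..n}. Xs i \<omega>) (\<lambda>\<omega>. \<lambda>i\<in>{1..n}. Ys i \<omega>) (\<lambda>\<omega>. \<lambda>i\<in>{1..n}. Zs i \<omega>)
          = (\<Sum>i=1..n. cond_max_leakage r (Xs i) (Ys i) (Zs i)))
   \<and> cond_max_leakage p X Y Z \<ge> ereal (cond_mutual_info p \<X> \<Y> \<Z> X Y Z)
   \<and> (\<exists>(q :: (nat \<times> nat \<times> nat) pmf) (A :: nat \<times> nat \<times> nat \<Rightarrow> nat) (B :: nat \<times> nat \<times> nat \<Rightarrow> nat)
         (C :: nat \<times> nat \<times> nat \<Rightarrow> nat).
        finite (range A) \<and> finite (range B) \<and> finite (range C) \<and>
        cond_max_leakage q A B C \<noteq> cond_max_leakage q B A C)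
   \<and> (markov_chain p Z X Y \<longrightarrow>
        cond_max_leakage p X Y Z \<le> max_leakage p X Y \<and>
        ((\<exists>z \<in> set_pmf (map_pmf Z p).
            set_pmf (map_pmf X (cond_pmf p {\<omega>. Z \<omega> = z})) = set_pmf (map_pmf X p)) \<longrightarrow>
         cond_max_leakage p X Y Z = max_leakage p X Y))
   \<and> max_leakage p X (\<lambda>\<omega>. (Y \<omega>, Z \<omega>)) \<le> max_leakage p X Z + cond_max_leakage p X Y Z"
proof -
  have subX: "X ` set_pmf p \<subseteq> \<X>" and subY: "Y ` set_pmf p \<subseteq> \<Y>"
    using assms(4,5) by auto
  have finX: "finite (X ` set_pmf p)" and finY: "finite (Y ` set_pmf p)"
    using subX subY assms(1,2) finite_subset by blast+
  have processing: "cond_max_leakage p X V Z \<le> min (cond_max_leakage p X Y Z) (cond_max_leakage p Y V Z)"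
    if M: "markov_chain_given p X Y V Z" for V :: "'w \<Rightarrow> 'v"
    using cond_max_leakage_mono[OF finX finX sum_max_data_processing_left[OF M]]
      cond_max_leakage_mono[OF finX finY sum_max_data_processing_right[OF M]] by simp
  have cards: "cond_max_leakage p X Y Z \<le> min (ereal (ln (real (card \<X>)))) (ereal (ln (real (card \<Y>))))"
  proof -
    have "card \<X> > 0" "card \<Y> > 0"
      using subX subY set_pmf_not_empty[of p] assms(1,2) by (auto simp: card_gt_0_iff)
    then show ?thesis
      using sum_max_le_card[OF assms(1) subX, of Y Z] sum_max_le_card_output[OF assms(2) subY, of X Z]
      by (simp add: cond_max_leakage_le_iff[OF finX] ennreal_of_nat_eq_real_of_nat)
  qed
  have zero: "cond_max_leakage p X Y Z = 0 \<longleftrightarrow> markov_chain p X Z Y"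
  proof -
    have "0 \<le> cond_max_leakage p X Y Z"
      using enn2real_sum_max(2)[OF finX, of Y Z] by (simp add: cond_max_leakage_eq[OF finX])
    then have "cond_max_leakage p X Y Z = 0 \<longleftrightarrow> cond_max_leakage p X Y Z \<le> ereal (ln 1)"
      by (auto simp: zero_ereal_def[symmetric])
    also have "\<dots> \<longleftrightarrow> sum_max p X Y Z \<le> 1"
      using cond_max_leakage_le_iff[OF finX, of 1 Y Z] by simp
    also have "\<dots> \<longleftrightarrow> markov_chain p X Z Y"
      using sum_max_le_1_if_markov markov_if_sum_max_le_1 by blast
    finally show ?thesis .
  qed
  have mutual: "ereal (cond_mutual_info p \<X> \<Y> \<Z> X Y Z) \<le> cond_max_leakage p X Y Z"
    using cond_mutual_info_le_ln_sum_max[OF assms] by (simp add: cond_max_leakage_eq[OF finX])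
  have unconditional: "cond_max_leakage p X Y Z \<le> max_leakage p X Y"
    if M: "markov_chain p Z X Y"
    using cond_max_leakage_mono[OF finX finX sum_max_le_unconditional[OF M]]
    by (simp only: max_leakage_eq[OF finX] cond_max_leakage_eq[OF finX])
  have unconditional_eq: "cond_max_leakage p X Y Z = max_leakage p X Y"
    if M: "markov_chain p Z X Y" and z: "z \<in> set_pmf (map_pmf Z p)"
      and supp: "set_pmf (map_pmf X (cond_pmf p {\<omega>. Z \<omega> = z})) = set_pmf (map_pmf X p)" for z
  proof -
    have "set_pmf p \<inter> {\<omega>. Z \<omega> = z} \<noteq> {}"
      using z by auto
    then have eq: "X ` (set_pmf p \<inter> {\<omega>. Z \<omega> = z}) = X ` set_pmf p"
      using supp by (simp add: set_cond_pmf)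
    have "\<exists>\<omega>\<in>set_pmf p. X \<omega> = x \<and> Z \<omega> = z" if "x \<in> X ` set_pmf p" for x
      using that unfolding eq[symmetric] by auto
    then have "sum_max p X Y (\<lambda>_. ()) \<le> sum_max p X Y Z"
      by (rule unconditional_le_sum_max[OF M])
    then have "max_leakage p X Y \<le> cond_max_leakage p X Y Z"
      using cond_max_leakage_mono[OF finX finX]
      by (simp only: max_leakage_eq[OF finX] cond_max_leakage_eq[OF finX])
    then show ?thesis
      using unconditional[OF M] by (rule antisym[rotated])
  qed
  have chain: "max_leakage p X (\<lambda>\<omega>. (Y \<omega>, Z \<omega>)) \<le> max_leakage p X Z + cond_max_leakage p X Y Z"
  proof -
    define k1 k2 where "k1 = enn2real (sum_max p X Z (\<lambda>_. ()))" and "k2 = enn2real (sum_max p X Y Z)"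
    have k1: "sum_max p X Z (\<lambda>_. ()) = ennreal k1" "1 \<le> k1" and k2: "sum_max p X Y Z = ennreal k2" "1 \<le> k2"
      using enn2real_sum_max[OF finX, of Z "\<lambda>_. ()"] enn2real_sum_max[OF finX, of Y Z]
      by (simp_all only: k1_def k2_def)
    have "sum_max p X (\<lambda>\<omega>. (Y \<omega>, Z \<omega>)) (\<lambda>_. ()) \<le> ennreal (k1 * k2)"
      using sum_max_pair_le[of p X Y Z] k1 k2 by (simp add: ennreal_mult)
    \<comment> \<open>With constant \<open>Z\<close> the conditional and the maximal leakage have
      the same closed form, so the comparison criterion for the former serves for the
      latter.\<close>
    then have "cond_max_leakage p X (\<lambda>\<omega>. (Y \<omega>, Z \<omega>)) (\<lambda>_. ()) \<le> ereal (ln (k1 * k2))"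
      using k1(2) k2(2) by (subst cond_max_leakage_le_iff[OF finX]) auto
    also have "\<dots> = max_leakage p X Z + cond_max_leakage p X Y Z"
      using k1(2) k2(2) by (simp add: max_leakage_eq[OF finX] cond_max_leakage_eq[OF finX] k1_def[symmetric] k2_def[symmetric] ln_mult)
    finally show ?thesis
      by (simp only: max_leakage_eq[OF finX] cond_max_leakage_eq[OF finX])
  qed
  show ?thesis
    using processing cards zero mutual cond_max_leakage_not_symmetric unconditional unconditional_eq chain
    by (intro conjI allI impI) (blast intro: cond_max_leakage_independent_vector)+
qed

end
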